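(* Let $p>3$ be a prime. Then $$\sum_{j=1}^{(p-1)/2}\frac{\binom{2j}{j}}{j^3}\left(\frac{1}{j^2}+H_j^{(2)}\right)\equiv-2\sum_{j=1}^{(p-1)/2}\frac{p}{j^4\binom{2p-2j}{p-j}}\left(\frac{1}{j^2}+H_j^{(2)}\right)\equiv\frac{8}{9}B_{p-5}\pmod p.$$
   Context: For $n\ge 0$, $H_n^{(2)}=\sum_{k=1}^n \frac1{k^2}$. The Bernoulli numbers $B_n$ are defined by $\frac{x}{e^x-1}=\sum_{n=0}^{\infty}B_n\frac{x^n}{n!}$. For rational numbers $a,b$, $a\equiv b\pmod{p}$ means that the $p$-adic valuation of $a-b$ is at least $1$ (i.e. $(a-b)/p$ has denominator prime to $p$). *)

theory Defs
  imports
    "HOL-Computational_Algebra.Primes"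
    "HOL-Computational_Algebra.Formal_Power_Series"
begin

definition harmonic2 :: "nat \<Rightarrow> rat" where
  "harmonic2 n = (\<Sum>k = 1..n. 1 / of_nat k ^ 2)"

text \<open>
  The Bernoulli numbers via the exponential generating function \<open>x / (e^x - 1)\<close>,
  so \<open>bernoulli 1 = - 1 / 2\<close>. The divisor has zero constant term; division of
  formal power series over a field cancels the common factor \<open>X\<close>
  (see \<open>bernoulli_gf\<close> below).
\<close>
definition bernoulli :: "nat \<Rightarrow> rat" where
  "bernoulli n = fact n * fps_nth (fps_X / (fps_exp 1 - 1)) n"

lemma bernoulli_gf:
  "Abs_fps (\<lambda>n. bernoulli n / fact n) * (fps_exp 1 - 1) = fps_X"
proof -
  have nz: "fps_exp (1::rat) - 1 \<noteq> 0"
  proof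
    assume "fps_exp (1::rat) - 1 = 0"
    then have "fps_nth (fps_exp (1::rat) - 1) 1 = 0" by simp
    then show False by simp
  qed
  have "subdegree (fps_exp (1::rat) - 1) = 1"
    by (rule subdegreeI) auto
  then have "fps_exp (1::rat) - 1 dvd fps_X"
    using nz by (simp add: fps_dvd_iff)
  moreover have "Abs_fps (\<lambda>n. bernoulli n / fact n) = fps_X / (fps_exp 1 - 1)"
    by (simp add: fps_eq_iff bernoulli_def)
  ultimately show ?thesis by simp
qed

text \<open>
  The value at \<open>0\<close>, conventionally infinite, is the junk value \<open>0\<close> here;
  \<open>rat_cong\<close> therefore treats equality separately.
\<close>
definition padic_val :: "nat \<Rightarrow> rat \<Rightarrow> int" where
  "padic_val p x =
     int (multiplicity (int p) (fst (quotient_of x))) -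
     int (multiplicity (int p) (snd (quotient_of x)))"

definition rat_cong :: "rat \<Rightarrow> rat \<Rightarrow> nat \<Rightarrow> bool" where
  "rat_cong a b p \<longleftrightarrow> a = b \<or> padic_val p (a - b) \<ge> 1"

lemma rat_cong_iff_coprime_denominator:
  assumes "prime p"
  shows "rat_cong a b p \<longleftrightarrow>
    coprime (snd (quotient_of ((a - b) / of_nat p))) (int p)"
proof (cases "a = b")
  case True
  then show ?thesis by (simp add: rat_cong_def)
next
  case False
  define x where "x = a - b"
  obtain n d where q: "quotient_of x = (n, d)" by fastforce
  have d: "d > 0" using q by (rule quotient_of_denom_pos)
  have c: "coprime n d" using q by (rule quotient_of_coprime)
  have x: "x = of_int n / of_int d" using q by (rule quotient_of_div)
  have n0: "n \<noteq> 0" using x False by (auto simp: x_def)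
  have P: "prime (int p)" using assms by simp
  have p0: "int p > 0" using prime_gt_0_nat[OF assms] by simp
  have "rat_cong a b p \<longleftrightarrow> int p dvd n"
  proof (cases "int p dvd n")
    case True
    then have "\<not> int p dvd d"
      using c P by (meson coprime_common_divisor not_prime_unit)
    then have "multiplicity (int p) d = 0" by (rule not_dvd_imp_multiplicity_0)
    moreover have "multiplicity (int p) n > 0"
      using True n0 P by (simp add: prime_multiplicity_gt_zero_iff)
    ultimately show ?thesis
      using True q by (simp add: rat_cong_def padic_val_def x_def)
  next
    case False
    then have "multiplicity (int p) n = 0" by (rule not_dvd_imp_multiplicity_0)
    then show ?thesis
      using False \<open>a \<noteq> b\<close> q by (simp add: rat_cong_def padic_val_def x_def)
  qed
  also have "\<dots> \<longleftrightarrow> coprime (snd (quotient_of (x / of_nat p))) (int p)"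
  proof -
    obtain m e where r: "quotient_of (x / of_nat p) = (m, e)" by fastforce
    have e: "e > 0" using r by (rule quotient_of_denom_pos)
    have c': "coprime m e" using r by (rule quotient_of_coprime)
    have "x / of_nat p = of_int m / of_int e" using r by (rule quotient_of_div)
    then have "(of_int (n * e) :: rat) = of_int (m * d * int p)"
      using d e p0 x by (simp add: field_simps)
    then have eq: "n * e = m * d * int p" by (simp only: of_int_eq_iff)
    show ?thesis
    proof
      assume "int p dvd n"
      then obtain k where "n = int p * k" ..
      then have "k * e = m * d" using eq p0 by simp
      then have "e dvd d"
        using c' by (metis coprime_commute coprime_dvd_mult_right_iff dvd_triv_right)
      moreover have "\<not> int p dvd d"
        using c P \<open>int p dvd n\<close> by (meson coprime_common_divisor not_prime_unit)
      ultimately have "\<not> int p dvd e" by (meson dvd_trans)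
      then show "coprime (snd (quotient_of (x / of_nat p))) (int p)"
        using prime_imp_coprime[OF P, of e] r by (simp add: coprime_commute)
    next
      assume "coprime (snd (quotient_of (x / of_nat p))) (int p)"
      then have "coprime (int p) e" using r by (simp add: coprime_commute)
      moreover have "int p dvd n * e" using eq by simp
      ultimately show "int p dvd n" by (simp add: coprime_dvd_mult_left_iff)
    qed
  qed
  finally show ?thesis by (simp add: x_def)
qed

end

theory Submission
  imports
    Defs
    "HOL-Number_Theory.Residues"
    "HOL-Computational_Algebra.Polynomial"
begin

text \<open>
  Modulo \<open>p\<close> the second sum is \<open>p W\<close> with
  \<open>W = (\<Sum>n<p. (1/n\<^sup>2 - H\<^sub>n\<^sub>-\<^sub>1) / (n\<^sup>4 C(2n,n)))\<close>, where \<open>H\<^sub>n\<close> is the harmonic sum of order 2;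
  this is the substitution \<open>j = p - n\<close>. Truncating Leshchiner's series for
  \<open>(\<Sum>n. (-1)\<^sup>n\<^sup>-\<^sup>1 / (n\<^sup>2 - y))\<close> at \<open>N = p - 1\<close> and comparing coefficients of \<open>y\<^sup>2\<close> expresses \<open>W\<close> through
  the coefficients of \<open>y\<^sup>2\<close> in two polynomials \<open>(\<Sum>k. a\<^sub>k (\<Prod>m<k. 1 - y/m\<^sup>2))\<close>, with
  \<open>a\<^sub>k = 1/(k\<^sup>2 C(2k,k))\<close> and \<open>a\<^sub>k = 1/k\<close>. These polynomials take the closed-form values
  \<open>(1 - cos (\<pi> i / 3)) / i\<^sup>2\<close> and \<open>(-1)\<^sup>i\<^sup>-\<^sup>1 / i\<close> at \<open>y = i\<^sup>2\<close>, so Lagrange interpolation at the points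
  \<open>i\<^sup>2\<close> with \<open>0 < i < p\<close> reduces the claim to the sums over \<open>i\<close> of \<open>cos (\<pi> i / 3) / i\<^sup>5\<close> and
  \<open>(-1)\<^sup>i / i\<^sup>5\<close>. These weights are periodic modulo 6, and Voronoi's congruence for the multipliers
  2, 3 and 6 evaluates such sums as rational multiples of the Bernoulli number. The prime 5, for
  which the power sums of exponent \<open>-4\<close> do not vanish, is checked directly.
\<close>

section \<open>p-adically integral rationals\<close>

locale p_local =
  fixes p :: nat
  assumes prime_p: "prime p"
begin

definition Zp :: "rat set" where
  "Zp = {of_int a / of_int b | a b. \<not> int p dvd b}"

text \<open>Arbitrary rationals are allowed on both sides, so a difference may be formed before
  integrality is known. The exponent matters: several congruences are proved modulo
  \<open>p ^ 2\<close> and then divided by \<open>p\<close>.\<close>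

definition p_cong :: "nat \<Rightarrow> rat \<Rightarrow> rat \<Rightarrow> bool" where
  "p_cong e x y \<longleftrightarrow> (x - y) / of_nat p ^ e \<in> Zp"

lemma p_pos: "p > 0"
  using prime_p by (rule prime_gt_0_nat)

lemma ZpI: "\<not> int p dvd b \<Longrightarrow> x = of_int a / of_int b \<Longrightarrow> x \<in> Zp"
  unfolding Zp_def by blast

lemma ZpE:
  assumes "x \<in> Zp"
  obtains a b where "\<not> int p dvd b" "b \<noteq> 0" "x = of_int a / of_int b"
  using assms unfolding Zp_def by fastforce

lemma not_dvd_mult: "\<not> int p dvd a \<Longrightarrow> \<not> int p dvd b \<Longrightarrow> \<not> int p dvd a * b"
  using prime_p by (simp add: prime_dvd_mult_iff)

lemma Zp_of_int [simp, intro]: "of_int a \<in> Zp"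
  by (rule ZpI[of 1 _ a]) (use prime_p in auto)

lemma Zp_of_nat [simp, intro]: "of_nat a \<in> Zp"
  using Zp_of_int[of "int a"] by simp

lemma Zp_0 [simp, intro]: "0 \<in> Zp"
  using Zp_of_int[of 0] by simp

lemma Zp_1 [simp, intro]: "1 \<in> Zp"
  using Zp_of_int[of 1] by simp

lemma Zp_numeral [simp, intro]: "numeral n \<in> Zp"
  using Zp_of_int[of "numeral n"] by simp

lemma Zp_fact [simp, intro]: "fact n \<in> Zp"
  using Zp_of_nat[of "fact n"] by simp

lemma Zp_add [intro]: assumes "x \<in> Zp" "y \<in> Zp" shows "x + y \<in> Zp"
proof -
  obtain a b where ab: "\<not> int p dvd b" "b \<noteq> 0" "x = of_int a / of_int b"
    using assms(1) by (rule ZpE)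
  obtain c d where cd: "\<not> int p dvd d" "d \<noteq> 0" "y = of_int c / of_int d"
    using assms(2) by (rule ZpE)
  show ?thesis
    by (rule ZpI[of "b * d" _ "a * d + c * b"])
       (use ab cd not_dvd_mult in \<open>auto simp: field_simps\<close>)
qed

lemma Zp_mult [intro]: assumes "x \<in> Zp" "y \<in> Zp" shows "x * y \<in> Zp"
proof -
  obtain a b where ab: "\<not> int p dvd b" "b \<noteq> 0" "x = of_int a / of_int b"
    using assms(1) by (rule ZpE)
  obtain c d where cd: "\<not> int p dvd d" "d \<noteq> 0" "y = of_int c / of_int d"
    using assms(2) by (rule ZpE)
  show ?thesis
    by (rule ZpI[of "b * d" _ "a * c"])
       (use ab cd not_dvd_mult in \<open>auto simp: field_simps\<close>)
qed

lemma Zp_uminus [intro]: "x \<in> Zp \<Longrightarrow> - x \<in> Zp"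
  using Zp_mult[OF Zp_of_int[of "-1"], of x] by simp

lemma Zp_diff [intro]: "x \<in> Zp \<Longrightarrow> y \<in> Zp \<Longrightarrow> x - y \<in> Zp"
  using Zp_add[OF _ Zp_uminus, of x y] by simp

lemma Zp_power [intro]: "x \<in> Zp \<Longrightarrow> x ^ n \<in> Zp"
  by (induction n) auto

lemma Zp_sum [intro]: "(\<And>i. i \<in> A \<Longrightarrow> f i \<in> Zp) \<Longrightarrow> sum f A \<in> Zp"
  by (induction A rule: infinite_finite_induct) auto

lemma Zp_divide_nat: assumes "x \<in> Zp" "\<not> p dvd n" shows "x / of_nat n \<in> Zp"
proof -
  have "1 / of_nat n \<in> Zp"
    by (rule ZpI[of "int n" _ 1]) (use assms in auto)
  with assms(1) have "x * (1 / of_nat n) \<in> Zp" by (rule Zp_mult)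
  then show ?thesis by simp
qed

lemma Zp_divide_power: "x \<in> Zp \<Longrightarrow> \<not> p dvd n \<Longrightarrow> x / of_nat n ^ k \<in> Zp"
  using Zp_divide_nat[of x "n ^ k"] prime_dvd_power[OF prime_p, of n k] by auto

lemma not_dvd_less: "0 < n \<Longrightarrow> n < p \<Longrightarrow> \<not> p dvd n"
  by (auto dest: dvd_imp_le)

lemma not_dvd_fact: "n < p \<Longrightarrow> \<not> p dvd fact n"
  using prime_p by (simp add: prime_dvd_fact_iff)

lemma Zp_divide_fact: "x \<in> Zp \<Longrightarrow> n < p \<Longrightarrow> x / fact n \<in> Zp"
  using Zp_divide_nat[of x "fact n"] by (simp add: not_dvd_fact)

section \<open>Congruences modulo powers of \<open>p\<close>\<close>

lemma p_cong_refl [simp, intro]: "p_cong e x x"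
  by (simp add: p_cong_def)

lemma p_cong_sym: "p_cong e x y \<Longrightarrow> p_cong e y x"
  unfolding p_cong_def by (drule Zp_uminus) (simp add: minus_divide_left)

lemma p_cong_trans [trans]: "p_cong e x y \<Longrightarrow> p_cong e y z \<Longrightarrow> p_cong e x z"
  unfolding p_cong_def by (drule (1) Zp_add) (simp add: add_divide_distrib[symmetric])

lemma p_cong_add: "p_cong e x y \<Longrightarrow> p_cong e x' y' \<Longrightarrow> p_cong e (x + x') (y + y')"
  unfolding p_cong_def by (drule (1) Zp_add) (simp add: add_divide_distrib[symmetric] algebra_simps)

lemma p_cong_mult_left: "c \<in> Zp \<Longrightarrow> p_cong e x y \<Longrightarrow> p_cong e (c * x) (c * y)"
  unfolding p_cong_def by (drule (1) Zp_mult) (simp add: algebra_simps)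

lemma p_cong_mult_right: "c \<in> Zp \<Longrightarrow> p_cong e x y \<Longrightarrow> p_cong e (x * c) (y * c)"
  using p_cong_mult_left[of c e x y] by (simp add: mult.commute)

lemma p_cong_uminus: "p_cong e x y \<Longrightarrow> p_cong e (- x) (- y)"
  using p_cong_mult_left[of "-1" e x y] Zp_uminus[OF Zp_1] by simp

lemma p_cong_diff: "p_cong e x y \<Longrightarrow> p_cong e x' y' \<Longrightarrow> p_cong e (x - x') (y - y')"
  using p_cong_add[OF _ p_cong_uminus, of e x y x' y'] by simp

text \<open>The factors are exchanged one after the other, first \<open>x'\<close> for
  \<open>y'\<close> next to \<open>x\<close>, then \<open>x\<close> for \<open>y\<close> next to
  \<open>y'\<close>; hence integrality is asked of \<open>x\<close> and \<open>y'\<close>.\<close>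

lemma p_cong_mult: "x \<in> Zp \<Longrightarrow> y' \<in> Zp \<Longrightarrow> p_cong e x y \<Longrightarrow> p_cong e x' y' \<Longrightarrow> p_cong e (x * x') (y * y')"
  by (rule p_cong_trans[OF p_cong_mult_left p_cong_mult_right])

lemma p_cong_sum: "(\<And>i. i \<in> A \<Longrightarrow> p_cong e (f i) (g i)) \<Longrightarrow> p_cong e (sum f A) (sum g A)"
  by (induction A rule: infinite_finite_induct) (auto intro: p_cong_add)

lemma p_cong_Zp: assumes "p_cong e x y" "y \<in> Zp" shows "x \<in> Zp"
proof -
  have "of_nat p ^ e * ((x - y) / of_nat p ^ e) + y \<in> Zp"
    using assms unfolding p_cong_def by (intro Zp_add Zp_mult Zp_power) auto
  then show ?thesis using p_pos by simp
qed

lemma p_cong_Suc: assumes "p_cong (Suc e) x y" shows "p_cong e x y"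
proof -
  have "of_nat p * ((x - y) / of_nat p ^ Suc e) \<in> Zp"
    using assms unfolding p_cong_def by (intro Zp_mult Zp_of_nat)
  moreover have "of_nat p * ((x - y) / of_nat p ^ Suc e) = (x - y) / of_nat p ^ e"
    using p_pos by simp
  ultimately show ?thesis by (simp add: p_cong_def)
qed

text \<open>The way down from modulo \<open>p ^ 2\<close> to modulo \<open>p\<close>: Bernoulli
  numbers and interpolation sums first appear multiplied by \<open>p\<close>.\<close>

lemma p_cong_p_mult_iff: "p_cong (Suc e) (of_nat p * x) (of_nat p * y) \<longleftrightarrow> p_cong e x y"
  using p_pos by (simp add: p_cong_def flip: right_diff_distrib)

lemma p_cong_p_mult_0: "x \<in> Zp \<Longrightarrow> p_cong (Suc 0) (of_nat p * x) 0"
  using p_pos by (simp add: p_cong_def)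

lemma p_cong_mult_cancel:
  assumes "\<not> p dvd n" "p_cong e (of_nat n * x) (of_nat n * y)"
  shows "p_cong e x y"
proof -
  have n: "n \<noteq> 0" using assms(1) by (intro notI) simp
  have "(of_nat n * x - of_nat n * y) / of_nat p ^ e / of_nat n \<in> Zp"
    using assms by (intro Zp_divide_nat) (simp_all add: p_cong_def)
  moreover have "(of_nat n * x - of_nat n * y) / of_nat p ^ e / of_nat n = (x - y) / of_nat p ^ e"
    using n by (simp flip: right_diff_distrib)
  ultimately show ?thesis by (simp add: p_cong_def)
qed

lemma p_cong_divide:
  assumes "\<not> p dvd n" "p_cong e x y"
  shows "p_cong e (x / of_nat n) (y / of_nat n)"
proof (rule p_cong_mult_cancel[OF assms(1)])
  have "n \<noteq> 0" using assms(1) by (intro notI) simp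
  then show "p_cong e (of_nat n * (x / of_nat n)) (of_nat n * (y / of_nat n))"
    using assms(2) by simp
qed

lemma p_cong_divide_power:
  assumes "\<not> p dvd n" "p_cong e x y"
  shows "p_cong e (x / of_nat n ^ k) (y / of_nat n ^ k)"
  using p_cong_divide[of "n ^ k" e x y] assms prime_dvd_power[OF prime_p, of n k] by auto

lemma p_cong_of_int:
  assumes "[a = b] (mod int p)"
  shows "p_cong (Suc 0) (of_int a) (of_int b)"
proof -
  obtain k where k: "a - b = int p * k"
    using assms by (auto simp: cong_iff_dvd_diff)
  have "(of_int a - of_int b :: rat) = of_int (a - b)" by simp
  also have "\<dots> = of_nat p * of_int k" by (simp add: k)
  finally show ?thesis using p_pos by (simp add: p_cong_def)
qed

text \<open>A reduced denominator divides every other denominator of the same number, so one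
  denominator prime to \<open>p\<close> settles the one returned by
  \<open>quotient_of\<close>.\<close>

lemma p_cong_imp_rat_cong:
  assumes "p_cong (Suc 0) a b"
  shows "rat_cong a b p"
proof -
  obtain m n where mn: "\<not> int p dvd n" "n \<noteq> 0" "(a - b) / of_nat p = of_int m / of_int n"
    using assms unfolding p_cong_def power_Suc0_right by (rule ZpE)
  obtain c d where q: "quotient_of ((a - b) / of_nat p) = (c, d)" by fastforce
  have d: "d > 0" using q by (rule quotient_of_denom_pos)
  have cop: "coprime c d" using q by (rule quotient_of_coprime)
  have "of_int m / of_int n = (of_int c / of_int d :: rat)"
    using quotient_of_div[OF q] mn by simp
  then have "(of_int (m * d) :: rat) = of_int (c * n)"
    using d mn by (simp add: field_simps)
  then have "m * d = c * n" by (simp only: of_int_eq_iff)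
  then have "d dvd n"
    using cop by (metis coprime_commute coprime_dvd_mult_right_iff dvd_triv_right)
  then have "\<not> int p dvd d" using mn(1) by (meson dvd_trans)
  then have "coprime (int p) d" using prime_p by (simp add: prime_imp_coprime)
  then show ?thesis
    using prime_p q by (simp add: rat_cong_iff_coprime_denominator coprime_commute)
qed

section \<open>Reflection of \<open>i\<close> to \<open>p - i\<close>, Wilson and Fermat\<close>

lemma p_cong_p_minus: "p_cong (Suc 0) (of_nat p + x) x"
  using p_pos by (simp add: p_cong_def)

text \<open>For exponent 1 the difference is \<open>p / (i * (p - i))\<close>; the general case
  takes powers.\<close>

lemma p_cong_inverse_reflect:
  assumes "0 < i" "i < p"
  shows "p_cong (Suc 0) (1 / of_nat (p - i) ^ s) ((-1) ^ s / of_nat i ^ s)"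
proof -
  have n: "\<not> p dvd i" "\<not> p dvd p - i"
    using not_dvd_less[of i] not_dvd_less[of "p - i"] assms by linarith+
  have 1: "p_cong (Suc 0) (1 / of_nat (p - i)) (- 1 / of_nat i)"
  proof -
    have "1 / of_nat (p - i) - (- 1 / of_nat i) = (of_nat p :: rat) / of_nat (p - i) / of_nat i"
      using assms by (simp add: field_simps of_nat_diff)
    then have "(1 / of_nat (p - i) - (- 1 / of_nat i)) / (of_nat p :: rat) = 1 / of_nat (p - i) / of_nat i"
      using p_pos by simp
    also have "\<dots> \<in> Zp" using n by (intro Zp_divide_nat) auto
    finally show ?thesis by (simp add: p_cong_def)
  qed
  have m: "(1 :: rat) / of_nat (p - i) \<in> Zp" "(- 1 :: rat) / of_nat i \<in> Zp"
    using n by (auto intro!: Zp_divide_nat)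
  have "p_cong (Suc 0) ((1 / of_nat (p - i)) ^ s) ((- 1 / of_nat i) ^ s)"
  proof (induction s)
    case (Suc s)
    then show ?case unfolding power_Suc using m 1 by (intro p_cong_mult Zp_power)
  qed simp
  then show ?thesis by (simp only: power_divide power_one)
qed

lemma sum_reflect: "(\<Sum>i = 1..p - 1. f (p - i)) = (\<Sum>i = 1..p - 1. f i)"
  by (rule sum.reindex_bij_witness[of _ "\<lambda>i. p - i" "\<lambda>i. p - i"]) auto

lemma p_cong_wilson: "p_cong (Suc 0) (fact (p - 1)) (- 1)"
  using p_cong_of_int[OF wilson_theorem[OF prime_p]] by simp

text \<open>Induction from Wilson's theorem: the factor \<open>p - 1 - k\<close> leaves the first
  factorial and \<open>k + 1\<close> enters the second. These two numbers add up to
  \<open>p\<close>, which flips the sign.\<close>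

lemma p_cong_fact_reflect:
  assumes "k < p"
  shows "p_cong (Suc 0) (fact (p - 1 - k) * fact k) ((-1) ^ Suc k)"
  using assms
proof (induction k)
  case 0
  then show ?case using p_cong_wilson by simp
next
  case (Suc k)
  then have IH: "p_cong (Suc 0) (fact (p - 1 - k) * fact k) ((-1) ^ Suc k)" by simp
  define m where "m = p - 1 - Suc k"
  have m: "p - 1 - k = Suc m" "p = Suc m + Suc k" using Suc.prems by (auto simp: m_def)
  have nd: "\<not> p dvd Suc m" using Suc.prems by (intro not_dvd_less) (auto simp: m_def)
  have "p_cong (Suc 0) (of_nat (Suc m) * (fact m * fact k)) ((-1) ^ Suc k)"
    using IH unfolding m(1) by (simp add: mult_ac)
  moreover have "p_cong (Suc 0) (of_nat (Suc k) * (fact m * fact k)) (- (of_nat (Suc m) * (fact m * fact k)))"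
  proof -
    have "of_nat (Suc k) * (fact m * fact k) - (- (of_nat (Suc m) * (fact m * fact k)))
        = (of_nat p * (fact m * fact k) :: rat)"
      by (subst m(2)) (simp add: algebra_simps)
    then show ?thesis using p_pos by (simp add: p_cong_def Zp_mult)
  qed
  ultimately have "p_cong (Suc 0) (of_nat (Suc k) * (fact m * fact k)) (- ((-1) ^ Suc k))"
    using p_cong_trans p_cong_uminus by blast
  then show ?case by (simp add: m_def mult_ac)
qed

text \<open>Trades negative exponents for nonnegative ones, where the power sum formula with
  Bernoulli numbers applies.\<close>

lemma p_cong_fermat_inverse:
  assumes "0 < i" "i < p" "s \<le> p - 1"
  shows "p_cong (Suc 0) (of_nat i ^ (p - 1 - s)) (1 / of_nat i ^ s)"
proof -
  have n: "\<not> p dvd i" using assms by (auto intro!: not_dvd_less)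
  have "[i ^ (p - 1) = 1] (mod p)" using fermat_theorem[OF prime_p n] .
  then have "[int i ^ (p - 1) = 1] (mod int p)"
    by (metis cong_int_iff of_nat_1 of_nat_power)
  from p_cong_of_int[OF this] have "p_cong (Suc 0) (of_nat i ^ (p - 1)) 1" by simp
  moreover have "(of_nat i :: rat) ^ (p - 1) = of_nat i ^ s * of_nat i ^ (p - 1 - s)"
    using assms by (simp flip: power_add)
  ultimately have "p_cong (Suc 0) (of_nat (i ^ s) * of_nat i ^ (p - 1 - s)) (of_nat (i ^ s) * (1 / of_nat i ^ s))"
    using assms by simp
  then show ?thesis
    by (rule p_cong_mult_cancel[rotated]) (use n prime_p prime_dvd_power in blast)
qed

end

section \<open>Power sums and Voronoi's congruence\<close>

text \<open>The geometric sum of the series \<open>exp (j x)\<close> times \<open>exp x - 1\<close>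
  telescopes to \<open>exp (n x) - 1\<close>. Multiplying by the Bernoulli series turns the factor
  \<open>exp x - 1\<close> into \<open>X\<close>, and the coefficients of order \<open>k + 1\<close>
  are compared.\<close>

lemma power_sum_bernoulli:
  "(\<Sum>j<n. of_nat j ^ k) / fact k =
    (\<Sum>i\<le>k. bernoulli i / fact i * (of_nat n ^ (Suc k - i) / fact (Suc k - i)))"
proof -
  define S :: "rat fps" where "S = (\<Sum>j<n. fps_exp (of_nat j))"
  define B where "B = Abs_fps (\<lambda>n. bernoulli n / fact n)"
  have tel: "(fps_exp 1 - 1) * S = fps_exp (of_nat n) - 1"
    unfolding S_def
  proof (induction n)
    case (Suc n)
    have "fps_exp (of_nat (Suc n)) = fps_exp 1 * fps_exp (of_nat n :: rat)"
      by (simp flip: fps_exp_add_mult)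
    with Suc show ?case by (simp add: algebra_simps)
  qed simp
  have "fps_X * S = B * (fps_exp (of_nat n) - 1)"
    using bernoulli_gf by (simp add: B_def mult.assoc flip: tel)
  then have "fps_nth (fps_X * S) (Suc k) = fps_nth (B * (fps_exp (of_nat n) - 1)) (Suc k)"
    by simp
  then have "fps_nth S k = (\<Sum>i=0..Suc k.  fps_nth B i * fps_nth (fps_exp (of_nat n) - 1) (Suc k - i))"
    by (subst (asm) fps_mult_nth[of B]) (simp only: fps_mult_fps_X_commute fps_X_mult_nth, simp)
  also have "\<dots> = (\<Sum>i\<le>k. fps_nth B i * fps_nth (fps_exp (of_nat n) - 1) (Suc k - i))"
    by (simp add: atLeast0AtMost)
  also have "\<dots> = (\<Sum>i\<le>k. bernoulli i / fact i * (of_nat n ^ (Suc k - i) / fact (Suc k - i)))"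
    by (intro sum.cong refl) (simp add: B_def)
  finally show ?thesis
    by (simp add: S_def fps_sum_nth sum_divide_distrib)
qed

context p_local
begin

text \<open>The power sum formula for \<open>n = 1\<close> is the usual recursion for Bernoulli
  numbers, and its denominators are factorials of numbers below \<open>p\<close>.\<close>

lemma bernoulli_Zp: "i < p - 1 \<Longrightarrow> bernoulli i \<in> Zp"
proof (induction i rule: less_induct)
  case (less k)
  have "(\<Sum>j<1::nat. (of_nat j :: rat) ^ k) / fact k =
      (\<Sum>i\<le>k. bernoulli i / fact i * (1 / fact (Suc k - i)))"
    using power_sum_bernoulli[of k 1] by simp
  also have "\<dots> = (\<Sum>i<k. bernoulli i / fact i * (1 / fact (Suc k - i))) + bernoulli k / fact k"
    by (simp flip: lessThan_Suc_atMost)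
  finally have eq: "bernoulli k = fact k * (0 ^ k / fact k
      - (\<Sum>i<k. bernoulli i / fact i * (1 / fact (Suc k - i))))"
    by (simp add: field_simps)
  show ?case
    by (subst eq, intro Zp_mult Zp_diff Zp_sum Zp_divide_fact Zp_power)
       (use less in \<open>auto intro!: Zp_divide_fact\<close>)
qed

text \<open>In the power sum formula the term of index \<open>i\<close> carries
  \<open>p ^ (k + 1 - i)\<close>, so only \<open>i = k\<close> survives modulo \<open>p ^ 2\<close>;
  all denominators are prime to \<open>p\<close>.\<close>

lemma power_sum_cong:
  assumes "0 < k" "k < p - 1"
  shows "p_cong 2 (\<Sum>j=1..p-1. of_nat j ^ k) (of_nat p * bernoulli k)"
proof -
  define T where "T = fact k * (\<Sum>i<k. bernoulli i / fact i * (of_nat p ^ (k - 1 - i) / fact (Suc k - i)))"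
  have T: "T \<in> Zp"
    unfolding T_def
    by (intro Zp_mult Zp_sum Zp_divide_fact Zp_power bernoulli_Zp Zp_fact Zp_of_nat)
       (use assms in auto)
  \<comment> \<open>The summand at 0 is \<open>0 ^ k\<close>, which vanishes because
    \<open>k\<close> is positive.\<close>
  have "{..<p} = insert 0 {1..p-1}" using p_pos by auto
  then have "(\<Sum>j=1..p-1. of_nat j ^ k :: rat) = (\<Sum>j<p. of_nat j ^ k)"
    using assms by simp
  also have "\<dots> = fact k * (\<Sum>i\<le>k. bernoulli i / fact i * (of_nat p ^ (Suc k - i) / fact (Suc k - i)))"
    using power_sum_bernoulli[where n = p and k = k] by (simp add: field_simps)
  also have "\<dots> = fact k * (\<Sum>i<k. bernoulli i / fact i * (of_nat p ^ (Suc k - i) / fact (Suc k - i)))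
      + of_nat p * bernoulli k"
    by (simp add: algebra_simps flip: lessThan_Suc_atMost)
  also have "fact k * (\<Sum>i<k. bernoulli i / fact i * (of_nat p ^ (Suc k - i) / fact (Suc k - i)))
      = of_nat p ^ 2 * T"
    unfolding T_def sum_distrib_left
  proof (rule sum.cong[OF refl])
    fix i assume "i \<in> {..<k}"
    then have "Suc k - i = Suc (Suc (k - 1 - i))" by auto
    then have "of_nat p ^ (Suc k - i) = (of_nat p ^ 2 * of_nat p ^ (k - 1 - i) :: rat)"
      by (simp add: power2_eq_square)
    then show "fact k * (bernoulli i / fact i * (of_nat p ^ (Suc k - i) / fact (Suc k - i)))
        = of_nat p ^ 2 * (fact k * (bernoulli i / fact i * (of_nat p ^ (k - 1 - i) / fact (Suc k - i))))"
      by simp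
  qed
  finally show ?thesis
    using T p_pos by (simp add: p_cong_def)
qed

text \<open>With exponent \<open>p - 1 - s\<close> in place of \<open>- s\<close>, the sum becomes
  \<open>p\<close> times an integral Bernoulli number.\<close>

lemma harmonic_power_cong_0:
  assumes "0 < s" "s < p - 1"
  shows "p_cong (Suc 0) (\<Sum>i=1..p-1. 1 / of_nat i ^ s) 0"
proof -
  have k: "0 < p - 1 - s" "p - 1 - s < p - 1" using assms by auto
  have "p_cong (Suc 0) (\<Sum>i=1..p-1. of_nat i ^ (p - 1 - s)) (\<Sum>i=1..p-1. 1 / of_nat i ^ s)"
    by (intro p_cong_sum p_cong_fermat_inverse) (use assms in auto)
  moreover have "p_cong (Suc 0) (\<Sum>i=1..p-1. of_nat i ^ (p - 1 - s)) (of_nat p * bernoulli (p - 1 - s))"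
    using power_sum_cong[OF k] by (simp add: numeral_2_eq_2 p_cong_Suc)
  moreover have "p_cong (Suc 0) (of_nat p * bernoulli (p - 1 - s)) 0"
    using k by (intro p_cong_p_mult_0 bernoulli_Zp)
  ultimately show ?thesis by (rule p_cong_trans[OF p_cong_trans[OF p_cong_sym]])
qed

section \<open>Voronoi's congruence\<close>

lemma p_cong_power_add_p_mult:
  assumes "x \<in> Zp" "y \<in> Zp"
  shows "p_cong 2 ((x + of_nat p * y) ^ Suc m) (x ^ Suc m + of_nat (Suc m) * of_nat p * y * x ^ m)"
proof (induction m)
  case (Suc m)
  have "p_cong 2 ((x + of_nat p * y) ^ Suc (Suc m))
      ((x + of_nat p * y) * (x ^ Suc m + of_nat (Suc m) * of_nat p * y * x ^ m))"
    unfolding power_Suc[of _ "Suc m"] using Suc assms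
    by (intro p_cong_mult_left Zp_add Zp_mult Zp_of_nat) auto
  also have "p_cong 2 \<dots> (x ^ Suc (Suc m) + of_nat (Suc (Suc m)) * of_nat p * y * x ^ Suc m)"
  proof -
    have "(x + of_nat p * y) * (x ^ Suc m + of_nat (Suc m) * of_nat p * y * x ^ m)
        - (x ^ Suc (Suc m) + of_nat (Suc (Suc m)) * of_nat p * y * x ^ Suc m)
        = of_nat p ^ 2 * (of_nat (Suc m) * y ^ 2 * x ^ m)"
      by (simp add: algebra_simps power2_eq_square)
    moreover have "of_nat (Suc m) * y ^ 2 * x ^ m \<in> Zp"
      using assms by (intro Zp_mult Zp_power Zp_of_nat)
    ultimately show ?thesis
      using p_pos by (simp only: p_cong_def) simp
  qed
  finally show ?case .
qed simp

text \<open>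
  If \<open>a\<close> divides \<open>p\<^sup>2 - 1\<close>, then \<open>quot a r\<close> is the residue of \<open>- r / p\<close> modulo \<open>a\<close>. Hence
  \<open>r + p * quot a r = a * j\<close> with \<open>0 < j < p\<close>, and \<open>quot a r\<close> is the integer part of
  \<open>a * j / p\<close>, the weight in Voronoi's congruence.
\<close>
definition quot :: "nat \<Rightarrow> nat \<Rightarrow> nat" where
  "quot a r = ((a - 1) * p * r) mod a"

text \<open>As \<open>p * p\<close> is 1 modulo \<open>a\<close>, the number
  \<open>p * quot a r\<close> is \<open>(a - 1) * r\<close>, that is \<open>- r\<close>, modulo
  \<open>a\<close>.\<close>

lemma dvd_add_quot:
  assumes "0 < a" "a dvd p\<^sup>2 - 1"
  shows "a dvd r + p * quot a r"
proof -
  have "[r + p * quot a r = r + p * ((a - 1) * p * r)] (mod a)"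
    unfolding quot_def by (intro cong_add cong_mult cong_refl) (simp add: cong_def)
  moreover have "a dvd r + p * ((a - 1) * p * r)"
  proof -
    obtain b where b: "a = Suc b" using assms(1) by (cases a) auto
    obtain k where "p\<^sup>2 - 1 = a * k" using assms(2) by (rule dvdE)
    then have "p * p = a * k + 1" using p_pos by (cases p) (simp_all add: power2_eq_square)
    moreover have "r + p * ((a - 1) * p * r) = r + b * r * (p * p)" using b by simp
    ultimately have "r + p * ((a - 1) * p * r) = a * (r + b * r * k)"
      by (simp add: b algebra_simps)
    then show ?thesis by simp
  qed
  ultimately show ?thesis
    by (simp add: cong_dvd_iff)
qed

text \<open>The map from \<open>r\<close> to \<open>j\<close> with
  \<open>a * j = r + p * quot a r\<close> permutes \<open>{1..p-1}\<close>: it is injective because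
  \<open>r\<close> is the residue of \<open>a * j\<close> modulo \<open>p\<close>, and
  \<open>quot a r < a\<close> forces \<open>a * j < a * p\<close>.\<close>

lemma sum_quot_reindex:
  fixes f :: "nat \<Rightarrow> rat"
  assumes "0 < a" "a dvd p\<^sup>2 - 1"
  shows "(\<Sum>r=1..p-1. f ((r + p * quot a r) div a)) = (\<Sum>j=1..p-1. f j)"
proof -
  define \<sigma> where "\<sigma> r = (r + p * quot a r) div a" for r
  have \<sigma>: "a * \<sigma> r = r + p * quot a r" for r
    unfolding \<sigma>_def using dvd_add_quot[OF assms] by simp
  have "inj_on \<sigma> {1..p-1}"
  proof (rule inj_onI)
    fix r s assume rs: "r \<in> {1..p-1}" "s \<in> {1..p-1}" "\<sigma> r = \<sigma> s"
    then have "(r + p * quot a r) mod p = (s + p * quot a s) mod p"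
      using \<sigma>[of r] \<sigma>[of s] by simp
    then have "r mod p = s mod p" by simp
    moreover have "r < p" "s < p" using rs by auto
    ultimately show "r = s" by simp
  qed
  moreover have "\<sigma> ` {1..p-1} \<subseteq> {1..p-1}"
  proof (rule image_subsetI)
    fix r assume r: "r \<in> {1..p-1}"
    have "quot a r \<le> a - 1" using assms(1) by (simp add: quot_def less_Suc_eq_le[symmetric])
    then have "p * quot a r \<le> p * (a - 1)" by simp
    moreover have "p * (a - 1) + p = a * p" using assms(1) by (simp add: algebra_simps)
    moreover have "r < p" using r by auto
    ultimately have "r + p * quot a r < a * p" by linarith
    then have "a * \<sigma> r < a * p" using \<sigma> by simp
    then have "\<sigma> r < p" by simp
    moreover have "a * \<sigma> r > 0" using \<sigma>[of r] r by simp
    then have "\<sigma> r > 0" by (cases "\<sigma> r") auto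
    ultimately show "\<sigma> r \<in> {1..p-1}" by simp
  qed
  ultimately have "bij_betw \<sigma> {1..p-1} {1..p-1}"
    unfolding bij_betw_def by (simp add: endo_inj_surj)
  then show ?thesis
    unfolding \<sigma>_def by (rule sum.reindex_bij_betw)
qed

text \<open>The sum of \<open>(a * j) ^ Suc m\<close> is computed twice modulo \<open>p ^ 2\<close>:
  as \<open>a ^ Suc m\<close> times a power sum, and through \<open>a * j = r + p * quot a r\<close>
  expanded to first order in \<open>p\<close>. Dividing by \<open>p\<close> gives the claim.\<close>

lemma voronoi:
  assumes "0 < a" "a dvd p\<^sup>2 - 1" "Suc m < p - 1"
  shows "p_cong (Suc 0) (of_nat a ^ Suc m * bernoulli (Suc m))
    (bernoulli (Suc m) + of_nat (Suc m) * (\<Sum>r=1..p-1. of_nat (quot a r) * of_nat r ^ m))"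
proof -
  define S :: rat where "S = (\<Sum>j=1..p-1. of_nat j ^ Suc m)"
  define V :: rat where "V = (\<Sum>r=1..p-1. of_nat (quot a r) * of_nat r ^ m)"
  have S: "p_cong 2 S (of_nat p * bernoulli (Suc m))"
    unfolding S_def using assms by (intro power_sum_cong) auto
  have "S = (\<Sum>r=1..p-1. of_nat ((r + p * quot a r) div a) ^ Suc m)"
    unfolding S_def by (rule sum_quot_reindex[OF assms(1,2), symmetric])
  then have "of_nat a ^ Suc m * S = (\<Sum>r=1..p-1. of_nat (a * ((r + p * quot a r) div a)) ^ Suc m)"
    by (simp only: sum_distrib_left power_mult_distrib of_nat_mult)
  also have "\<dots> = (\<Sum>r=1..p-1. (of_nat r + of_nat p * of_nat (quot a r)) ^ Suc m)"
    by (intro sum.cong refl, subst dvd_mult_div_cancel[OF dvd_add_quot[OF assms(1,2)]])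
       (simp only: of_nat_add of_nat_mult)
  also have "p_cong 2 \<dots> (\<Sum>r=1..p-1. of_nat r ^ Suc m + of_nat (Suc m) * of_nat p * of_nat (quot a r) * of_nat r ^ m)"
    by (intro p_cong_sum p_cong_power_add_p_mult) auto
  also have "\<dots> = S + of_nat p * (of_nat (Suc m) * V)"
    unfolding S_def V_def sum.distrib sum_distrib_left by (simp add: mult_ac del: of_nat_Suc)
  also have "p_cong 2 \<dots> (of_nat p * bernoulli (Suc m) + of_nat p * (of_nat (Suc m) * V))"
    by (intro p_cong_add S p_cong_refl)
  also have "\<dots> = of_nat p * (bernoulli (Suc m) + of_nat (Suc m) * V)"
    by (simp add: algebra_simps)
  finally have "p_cong 2 (of_nat a ^ Suc m * S) \<dots>" .
  moreover have "p_cong 2 (of_nat a ^ Suc m * S) (of_nat p * (of_nat a ^ Suc m * bernoulli (Suc m)))"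
    using p_cong_mult_left[OF _ S, of "of_nat a ^ Suc m"] by (auto simp: mult_ac simp del: power_Suc)
  ultimately have "p_cong 2 (of_nat p * (of_nat a ^ Suc m * bernoulli (Suc m)))
      (of_nat p * (bernoulli (Suc m) + of_nat (Suc m) * V))"
    by (rule p_cong_trans[OF p_cong_sym, rotated])
  then show ?thesis
    unfolding V_def numeral_2_eq_2 p_cong_p_mult_iff .
qed

text \<open>Voronoi's congruence at the Bernoulli index \<open>p - 5\<close>: by Fermat
  \<open>a ^ (p - 5)\<close> is \<open>1 / a ^ 4\<close> and \<open>r ^ (p - 6)\<close> is
  \<open>1 / r ^ 5\<close>, while the factor \<open>p - 5\<close> becomes \<open>- 5\<close>. The
  result is solved for the weighted sum.\<close>

lemma sum_quot_div_power_5: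
  assumes "6 < p" "0 < a" "a < p" "a dvd p\<^sup>2 - 1"
  shows "p_cong (Suc 0) (\<Sum>r=1..p-1. of_nat (quot a r) / of_nat r ^ 5)
    ((1 - 1 / of_nat a ^ 4) / 5 * bernoulli (p - 5))"
proof -
  define B where "B = bernoulli (p - 5)"
  define V :: rat where "V = (\<Sum>r=1..p-1. of_nat (quot a r) * of_nat r ^ (p - 6))"
  have B: "B \<in> Zp" unfolding B_def using assms by (intro bernoulli_Zp) auto
  have V: "V \<in> Zp" unfolding V_def by auto
  have "Suc (p - 6) = p - 5" using assms by simp
  then have 1: "p_cong (Suc 0) (of_nat a ^ (p - 5) * B) (B + of_nat (p - 5) * V)"
    using voronoi[OF assms(2,4), of "p - 6"] assms unfolding B_def V_def by simp
  have 2: "p_cong (Suc 0) (of_nat a ^ (p - 5) * B) (1 / of_nat a ^ 4 * B)"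
    using p_cong_fermat_inverse[of a 4] assms B by (intro p_cong_mult_right) auto
  have 3: "p_cong (Suc 0) (of_nat (p - 5) * V) (- 5 * V)"
    using assms p_pos by (intro p_cong_mult_right V) (simp add: p_cong_def of_nat_diff)
  have "p_cong (Suc 0) (1 / of_nat a ^ 4 * B) (B + - 5 * V)"
    by (rule p_cong_trans[OF p_cong_sym[OF 2] p_cong_trans[OF 1 p_cong_add[OF p_cong_refl 3]]])
  then have "p_cong (Suc 0) (B - 1 / of_nat a ^ 4 * B) (B - (B + - 5 * V))"
    by (intro p_cong_diff p_cong_refl)
  moreover have "B - 1 / of_nat a ^ 4 * B = of_nat 5 * ((1 - 1 / of_nat a ^ 4) / 5 * B)"
    by (simp add: left_diff_distrib)
  moreover have "B - (B + - 5 * V) = of_nat 5 * V" by simp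
  ultimately have "p_cong (Suc 0) (of_nat 5 * ((1 - 1 / of_nat a ^ 4) / 5 * B)) (of_nat 5 * V)"
    by (simp only:)
  then have "p_cong (Suc 0) (of_nat 5 * V) (of_nat 5 * ((1 - 1 / of_nat a ^ 4) / 5 * B))"
    by (rule p_cong_sym)
  then have 4: "p_cong (Suc 0) V ((1 - 1 / of_nat a ^ 4) / 5 * B)"
    by (rule p_cong_mult_cancel[rotated]) (use assms not_dvd_less[of 5] in auto)
  have 5: "p_cong (Suc 0) V (\<Sum>r=1..p-1. of_nat (quot a r) * (1 / of_nat r ^ 5))"
    unfolding V_def using assms p_cong_fermat_inverse[of _ 5]
    by (intro p_cong_sum p_cong_mult_left) auto
  show ?thesis
    using p_cong_trans[OF p_cong_sym[OF 5] 4] unfolding B_def by simp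
qed

end

section \<open>A finite form of a Leshchiner identity\<close>

text \<open>The second elementary symmetric function of the numbers \<open>1 / m ^ 2\<close> with
  \<open>1 <= m <= n\<close>.\<close>

definition nested2 :: "nat \<Rightarrow> rat" where
  "nested2 n = (\<Sum>m = 1..n. harmonic2 (m - 1) / of_nat m ^ 2)"

lemma harmonic2_0 [simp]: "harmonic2 0 = 0"
  by (simp add: harmonic2_def)

lemma harmonic2_Suc [simp]: "harmonic2 (Suc n) = harmonic2 n + 1 / of_nat (Suc n) ^ 2"
  by (simp add: harmonic2_def)

lemma nested2_0 [simp]: "nested2 0 = 0"
  by (simp add: nested2_def)

lemma nested2_Suc [simp]: "nested2 (Suc n) = nested2 n + harmonic2 n / of_nat (Suc n) ^ 2"
  by (simp add: nested2_def)

text \<open>Each factor splits as \<open>(n - m) * (n + m)\<close>. The two runs of consecutive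
  integers surround \<open>n\<close>, which is itself absent and therefore appears in the
  denominator.\<close>

lemma prod_diff_squares:
  assumes "k < n"
  shows "(\<Prod>m=1..k. (of_nat n)\<^sup>2 - (of_nat m)\<^sup>2) = (fact (n + k) / (of_nat n * fact (n - Suc k)) :: rat)"
  using assms
proof (induction k)
  case 0
  then show ?case by (cases n) simp_all
next
  case (Suc k)
  define d where "d = n - Suc (Suc k)"
  have n: "n = Suc (Suc (k + d))" using Suc.prems by (simp add: d_def)
  have "(\<Prod>m=1..Suc k. (of_nat n)\<^sup>2 - (of_nat m)\<^sup>2 :: rat)
      = fact (n + k) / (of_nat n * fact (Suc d)) * ((of_nat n)\<^sup>2 - (of_nat (Suc k))\<^sup>2)"
    using Suc n by simp
  also have "(of_nat n)\<^sup>2 - (of_nat (Suc k))\<^sup>2 = (of_nat (Suc (n + k)) * of_nat (Suc d) :: rat)"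
    by (simp add: n power2_eq_square algebra_simps)
  also have "fact (n + k) / (of_nat n * fact (Suc d)) * (of_nat (Suc (n + k)) * of_nat (Suc d))
      = fact (n + Suc k) / (of_nat n * fact d :: rat)"
    by (simp only: fact_Suc add_Suc_right) (simp add: divide_simps del: of_nat_Suc)
  finally show ?case by (simp only: d_def)
qed

lemma of_nat_central_binomial: "of_nat ((2 * n) choose n) = (fact (2 * n) / (fact n)\<^sup>2 :: rat)"
  using binomial_fact[of n "2 * n", where ?'a = rat] by (simp add: power2_eq_square mult_2)

text \<open>
  The coefficient of \<open>y\<^sup>2\<close> in Apery's partial fraction telescoping of \<open>1 / (n\<^sup>2 - y)\<close> with
  numerators \<open>(\<Prod>m<k. m\<^sup>2 - y)\<close>; stated numerically, so that it can be proved by induction.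
\<close>

lemma apery_partial_sum:
  assumes "K < n"
  shows "(\<Sum>k=1..K. - ((-1) ^ k * (fact (k - 1))\<^sup>2 * nested2 (k - 1)) / (\<Prod>m=1..k. (of_nat n)\<^sup>2 - (of_nat m)\<^sup>2))
    = 1 / of_nat n ^ 6 - (-1) ^ K * (fact K)\<^sup>2 / (\<Prod>m=1..K. (of_nat n)\<^sup>2 - (of_nat m)\<^sup>2)
        * (1 / of_nat n ^ 6 - harmonic2 K / of_nat n ^ 4 + nested2 K / of_nat n ^ 2)"
  using assms
proof (induction K)
  case (Suc K)
  \<comment> \<open>The expression \<open>1 / x ^ 3 - h / x ^ 2 + e / x\<close> is the coefficient
    of \<open>y ^ 2\<close> in \<open>(1 - h y + e y ^ 2) / (x - y)\<close>. Up to the factor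
    \<open>\<rho> / (x - M)\<close>, the identity is \<open>M (1 - y / M) + (x - M) = x - y\<close>,
    divided by \<open>x - y\<close> and multiplied by \<open>1 - h y + e y ^ 2\<close>.\<close>
  have alg: "\<rho> / (x - M) * e = \<rho> * (1 / x ^ 3 - h / x\<^sup>2 + e / x)
      + \<rho> * M / (x - M) * (1 / x ^ 3 - (h + 1 / M) / x\<^sup>2 + (e + h / M) / x)"
    if "x \<noteq> 0" "M \<noteq> 0" "x \<noteq> M" for x M \<rho> h e :: rat
  proof -
    have "M * (1 / x ^ 3 - (h + 1 / M) / x\<^sup>2 + (e + h / M) / x) + (x - M) * (1 / x ^ 3 - h / x\<^sup>2 + e / x) = e"
      using that by (simp add: field_simps power2_eq_square power3_eq_cube)
    then have "\<rho> / (x - M) * e = \<rho> / (x - M) *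
       (M * (1 / x ^ 3 - (h + 1 / M) / x\<^sup>2 + (e + h / M) / x) + (x - M) * (1 / x ^ 3 - h / x\<^sup>2 + e / x))"
      by simp
    also have "\<dots> = \<rho> * (1 / x ^ 3 - h / x\<^sup>2 + e / x)
      + \<rho> * M / (x - M) * (1 / x ^ 3 - (h + 1 / M) / x\<^sup>2 + (e + h / M) / x)"
    proof -
      have "\<rho> / (x - M) * (M * u + (x - M) * v) = \<rho> * v + \<rho> * M / (x - M) * u" for u v
        using that by (simp add: field_simps)
      then show ?thesis .
    qed
    finally show ?thesis .
  qed
  define x M D :: rat where "x = (of_nat n)\<^sup>2" and "M = (of_nat (Suc K))\<^sup>2"
    and "D = (\<Prod>m=1..K. (of_nat n)\<^sup>2 - (of_nat m)\<^sup>2)"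
  define \<rho> where "\<rho> = (-1) ^ K * (fact K)\<^sup>2 / D"
  have "x \<noteq> M"
  proof
    assume "x = M"
    then have "of_nat (n\<^sup>2) = (of_nat ((Suc K)\<^sup>2) :: rat)" unfolding x_def M_def of_nat_power .
    then have "n\<^sup>2 = (Suc K)\<^sup>2" by (simp only: of_nat_eq_iff)
    then show False using Suc.prems by (simp add: power2_eq_iff)
  qed
  then have a: "\<rho> / (x - M) * nested2 K = \<rho> * (1 / x ^ 3 - harmonic2 K / x\<^sup>2 + nested2 K / x)
      + \<rho> * M / (x - M) * (1 / x ^ 3 - (harmonic2 K + 1 / M) / x\<^sup>2 + (nested2 K + harmonic2 K / M) / x)"
    using Suc.prems by (intro alg) (simp_all add: x_def M_def del: of_nat_Suc)
  have pw: "x ^ 3 = of_nat n ^ 6" "x\<^sup>2 = of_nat n ^ 4" "x = of_nat n ^ 2"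
    by (simp_all add: x_def flip: power_mult)
  have D: "(\<Prod>m=1..Suc K. (of_nat n)\<^sup>2 - (of_nat m)\<^sup>2) = D * (x - M)"
    unfolding D_def x_def M_def by simp
  have "(\<Sum>k=1..Suc K. - ((-1) ^ k * (fact (k - 1))\<^sup>2 * nested2 (k - 1)) / (\<Prod>m=1..k. (of_nat n)\<^sup>2 - (of_nat m)\<^sup>2))
      = 1 / of_nat n ^ 6 - \<rho> * (1 / x ^ 3 - harmonic2 K / x\<^sup>2 + nested2 K / x) + \<rho> / (x - M) * nested2 K"
    using Suc D unfolding \<rho>_def pw by (simp add: D_def)
  also have "\<dots> = 1 / of_nat n ^ 6 + \<rho> * M / (x - M) * (1 / x ^ 3 - harmonic2 (Suc K) / x\<^sup>2 + nested2 (Suc K) / x)"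
    unfolding a harmonic2_Suc nested2_Suc M_def[symmetric] by simp
  also have "\<rho> * M / (x - M) = - ((-1) ^ Suc K * (fact (Suc K))\<^sup>2 / (D * (x - M)))"
    by (simp add: \<rho>_def M_def power_mult_distrib mult_ac del: of_nat_Suc)
  finally show ?case
    unfolding D pw by simp
qed simp

text \<open>The case \<open>K = n - 1\<close>, where the product is
  \<open>fact (2 * n - 1) / n\<close>, so that the remainder acquires the reciprocal of a central
  binomial coefficient.\<close>

lemma apery_sum:
  assumes "0 < n"
  shows "(\<Sum>k=1..n-1. - ((-1) ^ k * (fact (k - 1))\<^sup>2 * nested2 (k - 1)) * (of_nat n * fact (n - Suc k) / fact (n + k)))
    = 1 / of_nat n ^ 6 + (-1) ^ n * 2 / of_nat ((2 * n) choose n)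
        * (1 / of_nat n ^ 6 - harmonic2 (n - 1) / of_nat n ^ 4 + nested2 (n - 1) / of_nat n ^ 2)"
proof -
  obtain r where n: "n = Suc r" using assms by (cases n) auto
  have f1: "(\<Prod>m=1..r. (of_nat n)\<^sup>2 - (of_nat m)\<^sup>2) = (fact (n + r) / of_nat n :: rat)"
    using prod_diff_squares[of r n] by (simp add: n)
  have f2: "(fact (2 * n) :: rat) = 2 * of_nat n * fact (n + r)"
  proof -
    have "2 * n = Suc (n + r)" by (simp add: n)
    then have "(fact (2 * n) :: rat) = of_nat (2 * n) * fact (n + r)"
      by (metis fact_Suc)
    then show ?thesis by simp
  qed
  have f3: "(fact n :: rat) = of_nat n * fact r" "(-1 :: rat) ^ n = - ((-1) ^ r)" "(of_nat n :: rat) \<noteq> 0"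
    by (simp_all add: n del: of_nat_Suc)
  have gen: "s * f\<^sup>2 / (G / x) = - (- s * 2 / (2 * x * G / (x * f)\<^sup>2))" if "x \<noteq> 0" for s f G x :: rat
    using that by (simp add: power2_eq_square)
  have c: "(-1) ^ r * (fact r)\<^sup>2 / (\<Prod>m=1..r. (of_nat n)\<^sup>2 - (of_nat m)\<^sup>2)
      = - ((-1) ^ n * 2 / of_nat ((2 * n) choose n) :: rat)"
    unfolding of_nat_central_binomial f1 f2 f3(1,2) by (rule gen[OF f3(3)])
  have "(\<Sum>k=1..r. - ((-1) ^ k * (fact (k - 1))\<^sup>2 * nested2 (k - 1)) * (of_nat n * fact (n - Suc k) / fact (n + k)))
      = (\<Sum>k=1..r. - ((-1) ^ k * (fact (k - 1))\<^sup>2 * nested2 (k - 1)) / (\<Prod>m=1..k. (of_nat n)\<^sup>2 - (of_nat m)\<^sup>2))"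
  proof (rule sum.cong[OF refl])
    fix k assume "k \<in> {1..r}"
    then have "k < n" by (simp add: n)
    show "- ((-1) ^ k * (fact (k - 1))\<^sup>2 * nested2 (k - 1)) * (of_nat n * fact (n - Suc k) / fact (n + k))
        = - ((-1) ^ k * (fact (k - 1))\<^sup>2 * nested2 (k - 1)) / (\<Prod>m=1..k. (of_nat n)\<^sup>2 - (of_nat m)\<^sup>2)"
      unfolding prod_diff_squares[OF \<open>k < n\<close>] by simp
  qed
  also have "\<dots> = 1 / of_nat n ^ 6 - (-1) ^ r * (fact r)\<^sup>2 / (\<Prod>m=1..r. (of_nat n)\<^sup>2 - (of_nat m)\<^sup>2)
        * (1 / of_nat n ^ 6 - harmonic2 r / of_nat n ^ 4 + nested2 r / of_nat n ^ 2)"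
    by (rule apery_partial_sum) (simp add: n)
  finally show ?thesis
    unfolding c by (simp add: n)
qed

text \<open>The sum telescopes: the summand is half the difference of
  \<open>(-1) ^ n * fact (n - k) / fact (n + k)\<close> at \<open>n\<close> and
  \<open>n - 1\<close>, since \<open>(n - k) + (n + k) = 2 * n\<close>.\<close>

lemma alternating_factorial_sum:
  assumes "k \<le> N"
  shows "(\<Sum>n=Suc k..N. (-1) ^ n * (of_nat n * fact (n - Suc k) / fact (n + k)))
    = ((-1) ^ N * fact (N - k) / fact (N + k) - (-1) ^ k / fact (2 * k)) / (2 :: rat)"
  using assms
proof (induction N rule: dec_induct)
  case base
  then show ?case by (simp add: mult_2)
next
  case (step N)
  define d where "d = N - k"
  have N: "N = k + d" using step.hyps by (simp add: d_def)
  have e: "2 * of_nat (Suc N) * fact d / fact (Suc N + k) - fact d / fact (N + k)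
      = (fact (Suc d) / fact (Suc N + k) :: rat)"
  proof -
    have "fact (Suc N + k) = (of_nat (Suc N + k) * fact (N + k) :: rat)" by simp
    then have g: "fact d / fact (N + k) = (of_nat (Suc N + k) * fact d / fact (Suc N + k) :: rat)"
      by (simp del: of_nat_Suc of_nat_add)
    have "2 * of_nat (Suc N) * fact d - of_nat (Suc N + k) * fact d = (fact (Suc d) :: rat)"
      by (simp add: N algebra_simps)
    then show ?thesis unfolding g by (simp only: diff_divide_distrib[symmetric])
  qed
  have "(\<Sum>n=Suc k..Suc N. (-1) ^ n * (of_nat n * fact (n - Suc k) / fact (n + k)))
      = ((-1) ^ N * fact d / fact (N + k) - (-1) ^ k / fact (2 * k)) / 2
        + (-1) ^ Suc N * (of_nat (Suc N) * fact d / fact (Suc N + k) :: rat)"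
    using step by (simp add: d_def)
  also have "\<dots> = ((-1) ^ Suc N * (2 * of_nat (Suc N) * fact d / fact (Suc N + k) - fact d / fact (N + k))
        - (-1) ^ k / fact (2 * k)) / 2"
  proof -
    have "(s * f / G - z) / 2 + - s * (a * f / F) = (- s * (2 * a * f / F - f / G) - z) / 2" for s f G z a F :: rat
      by (simp add: algebra_simps diff_divide_distrib add_divide_distrib)
    then show ?thesis unfolding power_Suc mult_minus1 .
  qed
  also have "\<dots> = ((-1) ^ Suc N * fact (Suc N - k) / fact (Suc N + k) - (-1) ^ k / fact (2 * k)) / 2"
    unfolding e using step.hyps by (simp add: d_def Suc_diff_le)
  finally show ?case .
qed

lemma sum_triangle_swap:
  "(\<Sum>n=1..N. \<Sum>k=1..n-1. f n k) = (\<Sum>k=1..N. \<Sum>n=Suc k..N. f n k :: rat)" for N :: nat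
  unfolding sum.Sigma[OF finite_atLeastAtMost ballI[OF finite_atLeastAtMost]]
  by (rule sum.reindex_bij_witness[of _ "\<lambda>(a, b). (b, a)" "\<lambda>(a, b). (b, a)"]) auto

text \<open>\<open>apery_sum\<close> is added up with signs \<open>(-1) ^ n\<close>, the double sum
  is reordered and its inner sums telescope. Their lower end points reproduce the sum with
  \<open>nested2\<close> over central binomials with coefficient \<open>1 / 2\<close>, against 2 on
  the other side; hence \<open>3 / 2\<close>.\<close>

lemma leshchiner_finite:
  "2 * (\<Sum>n=1..N. (1 / of_nat n ^ 6 - harmonic2 (n - 1) / of_nat n ^ 4) / of_nat ((2 * n) choose n))
    = - (\<Sum>n=1..N. (-1) ^ n / of_nat n ^ 6)
      - 3 / 2 * (\<Sum>n=1..N. nested2 (n - 1) / (of_nat n ^ 2 * of_nat ((2 * n) choose n)))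
      - (-1) ^ N / 2 * (\<Sum>k=1..N. (-1) ^ k * (fact (k - 1))\<^sup>2 * nested2 (k - 1) * (fact (N - k) / fact (N + k)))"
proof -
  define t where "t k = - ((-1) ^ k * (fact (k - 1))\<^sup>2 * nested2 (k - 1))" for k
  define C where "C n = (of_nat ((2 * n) choose n) :: rat)" for n
  define A where "A = (\<Sum>n=1..N. (1 / of_nat n ^ 6 - harmonic2 (n - 1) / of_nat n ^ 4) / C n)"
  define B where "B = (\<Sum>n=1..N. nested2 (n - 1) / (of_nat n ^ 2 * C n))"
  define T where "T = (\<Sum>k=1..N. t k * (fact (N - k) / fact (N + k)))"
  have "(\<Sum>n=1..N. (-1) ^ n * (\<Sum>k=1..n-1. t k * (of_nat n * fact (n - Suc k) / fact (n + k))))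
      = (\<Sum>n=1..N. (-1) ^ n / of_nat n ^ 6
          + (2 * ((1 / of_nat n ^ 6 - harmonic2 (n - 1) / of_nat n ^ 4) / C n)
          + 2 * (nested2 (n - 1) / (of_nat n ^ 2 * C n))))"
  proof (rule sum.cong[OF refl])
    fix n assume "n \<in> {1..N}"
    then have n: "0 < n" by simp
    have s: "(-1) ^ n * ((-1) ^ n * y) = (y :: rat)" for y
      by (simp flip: mult.assoc power_mult_distrib)
    have ap: "(\<Sum>k=1..n-1. t k * (of_nat n * fact (n - Suc k) / fact (n + k)))
      = 1 / of_nat n ^ 6 + (-1) ^ n * (2 / C n * (1 / of_nat n ^ 6
          - harmonic2 (n - 1) / of_nat n ^ 4 + nested2 (n - 1) / of_nat n ^ 2))"
      using apery_sum[OF n] unfolding t_def C_def by simp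
    show "(-1) ^ n * (\<Sum>k=1..n-1. t k * (of_nat n * fact (n - Suc k) / fact (n + k)))
      = (-1) ^ n / of_nat n ^ 6 + (2 * ((1 / of_nat n ^ 6 - harmonic2 (n - 1) / of_nat n ^ 4) / C n)
          + 2 * (nested2 (n - 1) / (of_nat n ^ 2 * C n)))"
      unfolding ap distrib_left[of "(-1) ^ n"] s
      by (simp add: algebra_simps add_divide_distrib diff_divide_distrib)
  qed
  also have "\<dots> = (\<Sum>n=1..N. (-1) ^ n / of_nat n ^ 6) + (2 * A + 2 * B)"
    by (simp add: A_def B_def sum.distrib sum_distrib_left)
  finally have 1: "(\<Sum>n=1..N. (-1) ^ n * (\<Sum>k=1..n-1. t k * (of_nat n * fact (n - Suc k) / fact (n + k)))) = \<dots>" .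
  have "(\<Sum>n=1..N. (-1) ^ n * (\<Sum>k=1..n-1. t k * (of_nat n * fact (n - Suc k) / fact (n + k))))
      = (\<Sum>n=1..N. \<Sum>k=1..n-1. t k * ((-1) ^ n * (of_nat n * fact (n - Suc k) / fact (n + k))))"
    by (simp add: sum_distrib_left mult_ac)
  also have "\<dots> = (\<Sum>k=1..N. t k * (\<Sum>n=Suc k..N. (-1) ^ n * (of_nat n * fact (n - Suc k) / fact (n + k))))"
    unfolding sum_triangle_swap sum_distrib_left ..
  also have "\<dots> = (\<Sum>k=1..N. (-1) ^ N / 2 * (t k * (fact (N - k) / fact (N + k)))
      + 1 / 2 * (nested2 (k - 1) / (of_nat k ^ 2 * C k)))"
  proof (rule sum.cong[OF refl])
    fix k assume k: "k \<in> {1..N}"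
    then obtain r where r: "k = Suc r" by (cases k) auto
    have "- (t k * (-1) ^ k / fact (2 * k)) = (fact (k - 1))\<^sup>2 * nested2 (k - 1) / fact (2 * k)"
      by (simp add: t_def flip: power_mult_distrib)
    also have "\<dots> = nested2 (k - 1) / (of_nat k ^ 2 * C k)"
      unfolding C_def of_nat_central_binomial
      by (simp add: r power_mult_distrib del: of_nat_Suc)
    finally have e: "- (t k * (-1) ^ k / fact (2 * k)) = \<dots>" .
    show "t k * (\<Sum>n=Suc k..N. (-1) ^ n * (of_nat n * fact (n - Suc k) / fact (n + k)))
      = (-1) ^ N / 2 * (t k * (fact (N - k) / fact (N + k))) + 1 / 2 * (nested2 (k - 1) / (of_nat k ^ 2 * C k))"
      unfolding e[symmetric] using k
      by (subst alternating_factorial_sum) (simp_all add: algebra_simps diff_divide_distrib)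
  qed
  also have "\<dots> = (-1) ^ N / 2 * T + 1 / 2 * B"
    by (simp add: T_def B_def sum.distrib sum_distrib_left)
  finally have "(\<Sum>n=1..N. (-1) ^ n / of_nat n ^ 6) + (2 * A + 2 * B) = (-1) ^ N / 2 * T + 1 / 2 * B"
    using 1 by simp
  moreover have "T = - (\<Sum>k=1..N. (-1) ^ k * (fact (k - 1))\<^sup>2 * nested2 (k - 1) * (fact (N - k) / fact (N + k)))"
    by (simp add: T_def t_def sum_negf)
  ultimately show ?thesis
    unfolding A_def B_def C_def by (simp add: algebra_simps)
qed

section \<open>Interpolation at the squares\<close>

definition sq_factor :: "nat \<Rightarrow> rat poly" where
  "sq_factor m = [:1, - 1 / of_nat m ^ 2:]"

lemma poly_sq_factor: "poly (sq_factor m) x = 1 - x / of_nat m ^ 2"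
  by (simp add: sq_factor_def)

definition sq_prod :: "nat \<Rightarrow> rat poly" where
  "sq_prod n = (\<Prod>m=1..n. sq_factor m)"

lemma sq_prod_Suc: "sq_prod (Suc n) = sq_factor (Suc n) * sq_prod n"
  by (simp add: sq_prod_def mult.commute)

lemma coeff_sq_factor_mult:
  "coeff (sq_factor m * q) 0 = coeff q 0"
  "coeff (sq_factor m * q) (Suc n) = coeff q (Suc n) - coeff q n / of_nat m ^ 2"
  by (simp_all add: sq_factor_def mult_pCons_left)

text \<open>These are the signed elementary symmetric functions of the \<open>1 / m ^ 2\<close>.
  Through them \<open>nested2\<close> becomes a coefficient of a polynomial that can be
  interpolated.\<close>

lemma coeff_sq_prod:
  "coeff (sq_prod n) 0 = 1"
  "coeff (sq_prod n) 1 = - harmonic2 n"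
  "coeff (sq_prod n) 2 = nested2 n"
proof -
  have "coeff (sq_prod n) 0 = 1 \<and> coeff (sq_prod n) 1 = - harmonic2 n \<and> coeff (sq_prod n) 2 = nested2 n"
  proof (induction n)
    case 0
    then show ?case by (simp add: sq_prod_def)
  next
    case (Suc n)
    then show ?case
      by (simp add: sq_prod_Suc coeff_sq_factor_mult numeral_2_eq_2 del: of_nat_Suc)
  qed
  then show "coeff (sq_prod n) 0 = 1" "coeff (sq_prod n) 1 = - harmonic2 n" "coeff (sq_prod n) 2 = nested2 n"
    by auto
qed

lemma degree_prod_sq_factor: "degree (prod sq_factor A) \<le> card A"
proof (induction A rule: infinite_finite_induct)
  case (insert m A)
  have "degree (sq_factor m * prod sq_factor A) \<le> degree (sq_factor m) + degree (prod sq_factor A)"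
    by (rule degree_mult_le)
  also have "\<dots> \<le> 1 + card A"
    using insert by (intro add_mono) (simp_all add: sq_factor_def)
  finally show ?case using insert by simp
qed auto

lemma poly_sq_prod_square:
  assumes "k < i"
  shows "poly (sq_prod k) (of_nat i ^ 2) = (-1) ^ k * fact (i + k) / (of_nat i * fact (i - Suc k) * (fact k)\<^sup>2)"
proof -
  have "poly (sq_prod k) (of_nat i ^ 2) = (\<Prod>m=1..k. - (((of_nat i)\<^sup>2 - (of_nat m)\<^sup>2) / of_nat m ^ 2))"
    unfolding sq_prod_def poly_prod poly_sq_factor by (intro prod.cong) (auto simp: field_simps)
  also have "\<dots> = (\<Prod>m=1..k. (-1) * (((of_nat i)\<^sup>2 - (of_nat m)\<^sup>2) / of_nat m ^ 2))"
    by (simp only: mult_minus1)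
  also have "\<dots> = (-1) ^ k * (\<Prod>m=1..k. (of_nat i)\<^sup>2 - (of_nat m)\<^sup>2) / (\<Prod>m=1..k. of_nat m ^ 2)"
    by (simp only: prod.distrib prod_dividef) simp
  also have "(\<Prod>m=1..k. of_nat m ^ 2 :: rat) = (fact k)\<^sup>2"
    by (simp add: fact_prod prod_power_distrib)
  finally show ?thesis
    unfolding prod_diff_squares[OF assms] by simp
qed

lemma poly_sq_prod_square_0:
  assumes "1 \<le> i" "i \<le> k"
  shows "poly (sq_prod k) (of_nat i ^ 2) = 0"
  unfolding sq_prod_def poly_prod poly_sq_factor using assms by (intro prod_zero bexI[of _ i]) auto

text \<open>The Lagrange normalization at the node \<open>i ^ 2\<close>: the reciprocal of the
  product of \<open>1 - i ^ 2 / m ^ 2\<close> over \<open>m\<close> in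
  \<open>{1..N} - {i}\<close>.\<close>

definition weight :: "nat \<Rightarrow> nat \<Rightarrow> rat" where
  "weight N i = - ((-1) ^ i * 2 * (fact N)\<^sup>2 / (fact (N - i) * fact (N + i)))"

text \<open>Induction on \<open>N\<close> from \<open>N = i\<close>, where the product is
  \<open>sq_prod (i - 1)\<close> at \<open>i ^ 2\<close>; each further node multiplies the weight by
  the reciprocal of its factor.\<close>

lemma weight_mult_prod:
  assumes "1 \<le> i" "i \<le> N"
  shows "weight N i * poly (prod sq_factor ({1..N} - {i})) (of_nat i ^ 2) = 1"
  using assms(2)
proof (induction N rule: dec_induct)
  case base
  obtain r where r: "i = Suc r" using assms(1) by (cases i) auto
  have "{1..i} - {i} = {1..r}" by (auto simp: r)
  then have 1: "poly (prod sq_factor ({1..i} - {i})) (of_nat i ^ 2) = (-1) ^ r * fact (i + r) / (of_nat i * (fact r)\<^sup>2)"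
    using poly_sq_prod_square[of r i] by (simp add: r sq_prod_def)
  have "i + i = Suc (i + r)" by (simp add: r)
  then have "(fact (i + i) :: rat) = of_nat (i + i) * fact (i + r)" by (metis fact_Suc)
  then have f2: "(fact (i + i) :: rat) = 2 * of_nat i * fact (i + r)" by simp
  have f3: "(fact i :: rat) = of_nat i * fact r" "(-1 :: rat) ^ i = - ((-1) ^ r)" "(of_nat i :: rat) \<noteq> 0"
    by (simp_all add: r del: of_nat_Suc)
  have s: "((-1) ^ r * (-1) ^ r :: rat) = 1" by (simp flip: power_mult_distrib)
  have gen: "- (- s * 2 * (x * f)\<^sup>2 / (fact 0 * (2 * x * G))) * (s * G / (x * f\<^sup>2)) = 1"
    if "x \<noteq> 0" "f \<noteq> 0" "G \<noteq> 0" "s * s = 1" for s x f G :: rat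
    using that by (simp add: power2_eq_square)
  show ?case
    unfolding 1 weight_def f2 f3(1,2) diff_self_eq_0
    by (rule gen) (use f3 s in auto)
next
  case (step N)
  define d where "d = N - i"
  have N: "N = i + d" using step.hyps by (simp add: d_def)
  have "{1..Suc N} - {i} = insert (Suc N) ({1..N} - {i})" using step.hyps by auto
  then have "poly (prod sq_factor ({1..Suc N} - {i})) (of_nat i ^ 2)
      = (1 - of_nat i ^ 2 / of_nat (Suc N) ^ 2) * poly (prod sq_factor ({1..N} - {i})) (of_nat i ^ 2)"
    by (simp add: poly_sq_factor del: of_nat_Suc)
  moreover have "weight (Suc N) i * (1 - of_nat i ^ 2 / of_nat (Suc N) ^ 2) = weight N i"
  proof -
    have 1: "Suc N - i = Suc d" "N - i = d" by (simp_all add: N)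
    have "(of_nat (Suc N) ^ 2 - of_nat i ^ 2 :: rat) = of_nat (Suc d) * of_nat (Suc (N + i))"
      by (simp add: N power2_eq_square algebra_simps)
    then have 2: "(1 - of_nat i ^ 2 / of_nat (Suc N) ^ 2 :: rat) = of_nat (Suc d) * of_nat (Suc (N + i)) / of_nat (Suc N) ^ 2"
      by (simp add: diff_divide_distrib[symmetric] divide_simps del: of_nat_Suc)
    have gen: "- (s * 2 * (M * f)\<^sup>2 / (D * g * (E * h))) * (D * E / M\<^sup>2) = - (s * 2 * f\<^sup>2 / (g * h))"
      if "M \<noteq> 0" "D \<noteq> 0" "E \<noteq> 0" for s M f D g E h :: rat
      using that by (simp add: power2_eq_square)
    show ?thesis
      unfolding weight_def 1 2 fact_Suc add_Suc by (rule gen) (simp_all del: of_nat_Suc)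
  qed
  ultimately show ?case using step.IH by (metis mult.assoc)
qed

lemma interpolation_sum:
  fixes f :: "rat poly"
  assumes "degree f < N"
  shows "f = (\<Sum>i=1..N. smult (weight N i * poly f (of_nat i ^ 2)) (prod sq_factor ({1..N} - {i})))"
    (is "f = ?g")
proof (rule poly_eqI_degree[where A = "(\<lambda>i. of_nat i ^ 2) ` {1..N}"])
  have "inj_on (\<lambda>i. of_nat i ^ 2 :: rat) {1..N}"
    by (rule inj_onI) (simp add: power2_eq_iff_nonneg)
  then have card: "card ((\<lambda>i. of_nat i ^ 2 :: rat) ` {1..N}) = N"
    by (simp add: card_image)
  then show "degree f < card ((\<lambda>i. of_nat i ^ 2 :: rat) ` {1..N})" using assms by simp
  have "degree ?g \<le> N - 1"
  proof (rule degree_sum_le)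
    fix i assume i: "i \<in> {1..N}"
    have "degree (smult (weight N i * poly f (of_nat i ^ 2)) (prod sq_factor ({1..N} - {i})))
        \<le> degree (prod sq_factor ({1..N} - {i}))"
      by (rule degree_smult_le)
    also have "\<dots> \<le> card ({1..N} - {i})" by (rule degree_prod_sq_factor)
    also have "\<dots> = N - 1" using i by simp
    finally show "degree (smult (weight N i * poly f (of_nat i ^ 2)) (prod sq_factor ({1..N} - {i}))) \<le> N - 1" .
  qed simp
  then show "degree ?g < card ((\<lambda>i. of_nat i ^ 2 :: rat) ` {1..N})"
    using assms by (simp only: card)
  fix x :: rat assume "x \<in> (\<lambda>i. of_nat i ^ 2) ` {1..N}"
  then obtain j where j: "j \<in> {1..N}" "x = of_nat j ^ 2" by auto
  have "poly ?g x = (\<Sum>i=1..N. weight N i * poly f (of_nat i ^ 2) * poly (prod sq_factor ({1..N} - {i})) x)"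
    by (simp add: poly_sum)
  also have "\<dots> = weight N j * poly f (of_nat j ^ 2) * poly (prod sq_factor ({1..N} - {j})) x"
  proof (rule sum.remove[OF _ j(1), THEN trans])
    have "(\<Sum>i\<in>{1..N} - {j}. weight N i * poly f (of_nat i ^ 2) * poly (prod sq_factor ({1..N} - {i})) x) = 0"
    proof (rule sum.neutral, rule ballI)
      fix i assume "i \<in> {1..N} - {j}"
      then have "poly (prod sq_factor ({1..N} - {i})) x = 0"
        unfolding poly_prod poly_sq_factor using j by (intro prod_zero bexI[of _ j]) auto
      then show "weight N i * poly f (of_nat i ^ 2) * poly (prod sq_factor ({1..N} - {i})) x = 0" by simp
    qed
    then show "weight N j * poly f (of_nat j ^ 2) * poly (prod sq_factor ({1..N} - {j})) x
        + (\<Sum>i\<in>{1..N} - {j}. weight N i * poly f (of_nat i ^ 2) * poly (prod sq_factor ({1..N} - {i})) x)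
        = weight N j * poly f (of_nat j ^ 2) * poly (prod sq_factor ({1..N} - {j})) x"
      by simp
  qed simp
  also have "\<dots> = poly f x * (weight N j * poly (prod sq_factor ({1..N} - {j})) (of_nat j ^ 2))"
    by (simp add: j)
  also have "\<dots> = poly f x"
    using weight_mult_prod[of j N] j by simp
  finally show "poly f x = poly ?g x" ..
qed

text \<open>Dividing \<open>sq_prod N\<close> by one factor gives the low coefficients of the
  Lagrange basis. The coefficients 0 and 1 of \<open>f\<close> determine \<open>S 0\<close> and
  \<open>S 2\<close>, which are eliminated, so that only \<open>S 4\<close> is left as a sum over
  the nodes.\<close>

lemma interpolation_coeff_2:
  assumes "degree f < N"
  shows "coeff f 2 = nested2 N * coeff f 0 - harmonic2 N * (coeff f 1 + harmonic2 N * coeff f 0)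
    + (\<Sum>i=1..N. weight N i * poly f (of_nat i ^ 2) / of_nat i ^ 4)"
proof -
  define c where "c i = weight N i * poly f (of_nat i ^ 2)" for i
  define Q where "Q i = prod sq_factor ({1..N} - {i})" for i
  define S where "S s = (\<Sum>i=1..N. c i / of_nat i ^ s)" for s :: nat
  have Q: "coeff (Q i) 0 = 1" "coeff (Q i) 1 = - harmonic2 N + 1 / of_nat i ^ 2"
    "coeff (Q i) 2 = nested2 N - harmonic2 N / of_nat i ^ 2 + 1 / of_nat i ^ 4" if "i \<in> {1..N}" for i
  proof -
    have "sq_prod N = sq_factor i * Q i"
      unfolding sq_prod_def Q_def using that by (subst prod.remove[of _ i]) auto
    then have e: "coeff (sq_factor i * Q i) n = coeff (sq_prod N) n" for n by simp
    from e[of 0] show 0: "coeff (Q i) 0 = 1" by (simp add: coeff_sq_factor_mult coeff_sq_prod)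
    from e[of 1] show 1: "coeff (Q i) 1 = - harmonic2 N + 1 / of_nat i ^ 2"
      using 0 coeff_sq_factor_mult(2)[of i "Q i" 0] coeff_sq_prod(2)[of N] by simp
    have "coeff (Q i) 2 = nested2 N + coeff (Q i) 1 / of_nat i ^ 2"
      using e[of 2] coeff_sq_factor_mult(2)[of i "Q i" 1, unfolded Suc_1] coeff_sq_prod(3)[of N] by simp
    then show "coeff (Q i) 2 = nested2 N - harmonic2 N / of_nat i ^ 2 + 1 / of_nat i ^ 4"
      unfolding 1 by (simp add: diff_divide_distrib flip: power_add)
  qed
  have f: "coeff f n = (\<Sum>i=1..N. c i * coeff (Q i) n)" for n
    using arg_cong[OF interpolation_sum[OF assms], of "\<lambda>q. coeff q n"]
    by (simp add: coeff_sum c_def Q_def)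
  have f0: "coeff f 0 = S 0" unfolding f S_def by (intro sum.cong) (simp_all add: Q)
  have "coeff f 1 = (\<Sum>i=1..N. - harmonic2 N * (c i / of_nat i ^ 0) + c i / of_nat i ^ 2)"
    unfolding f by (intro sum.cong refl) (simp only: Q, simp add: algebra_simps)
  then have f1: "coeff f 1 = - harmonic2 N * S 0 + S 2"
    unfolding S_def sum.distrib sum_distrib_left by simp
  have "coeff f 2 = (\<Sum>i=1..N. nested2 N * (c i / of_nat i ^ 0) - harmonic2 N * (c i / of_nat i ^ 2) + c i / of_nat i ^ 4)"
    unfolding f by (intro sum.cong refl) (simp only: Q, simp add: algebra_simps)
  then have "coeff f 2 = nested2 N * S 0 - harmonic2 N * S 2 + S 4"
    unfolding S_def sum.distrib sum_distrib_left sum_subtractf by simp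
  then show ?thesis
    using f0 f1 unfolding S_def c_def by simp
qed

section \<open>Values of \<open>harmonic_poly\<close> at squares: alternating factorial sums\<close>

lemma alternating_sum_step:
  assumes "0 < r" "J \<le> r"
  shows "(\<Sum>j<J. (-1) ^ j * fact (Suc r + j) / (fact (r - j) * fact j * fact (Suc j)))
      + (\<Sum>j<J. (-1) ^ j * fact (r + j) / (fact (r - Suc j) * fact j * fact (Suc j)))
    = - ((-1) ^ J * of_nat (2 * r + 1) * of_nat J * fact (r + J)
        / (fact (r - J) * (fact J)\<^sup>2 * of_nat (r * Suc r)) :: rat)"
  using assms(2)
proof (induction J)
  case (Suc J)
  define d where "d = r - Suc J"
  have r: "r = J + Suc d" "r - J = Suc d" "r - Suc J = d" using Suc.prems by (simp_all add: d_def)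
  have gen: "- (s * t * J * F / (a * G * j\<^sup>2 * (R * (R + 1)))) + s * ((R + J + 1) * F) / (a * G * j * (b * j))
      + s * F / (G * j * (b * j))
      = - (- s * t * b * ((R + J + 1) * F) / (G * (b * j)\<^sup>2 * (R * (R + 1))))"
    if "R = J + a" "b = J + 1" "t = 2 * R + 1" "a \<noteq> 0" "b \<noteq> 0" "G \<noteq> 0" "j \<noteq> 0" "R \<noteq> 0" "R + 1 \<noteq> 0"
    for s t J F a G j R b :: rat
  proof -
    \<comment> \<open>This relation makes the closed form telescope when \<open>J\<close> grows by
      one; \<open>R\<close>, \<open>a\<close>, \<open>b\<close> stand for \<open>r\<close>,
      \<open>r - J\<close>, \<open>J + 1\<close>.\<close>
    have k: "(R + J + 1) * a + J * b = R * (R + 1)"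
      unfolding that(1,2) by (simp add: algebra_simps)
    define c where "c = s * F / (G * j\<^sup>2)"
    have "s * ((R + J + 1) * F) / (a * G * j * (b * j)) + s * F / (G * j * (b * j)) = c * t / (a * b)"
      using that(4-7) unfolding c_def that(3) that(1)
      by (simp add: divide_simps power2_eq_square) (simp add: algebra_simps)
    moreover have "- (- s * t * b * ((R + J + 1) * F) / (G * (b * j)\<^sup>2 * (R * (R + 1))))
       + s * t * J * F / (a * G * j\<^sup>2 * (R * (R + 1)))
       = c * t * (((R + J + 1) * a + J * b) / (a * b * (R * (R + 1))))"
      using that(4-9) unfolding c_def
      by (simp add: divide_simps power2_eq_square) (simp add: algebra_simps)
    moreover have "((R + J + 1) * a + J * b) / (a * b * (R * (R + 1))) = 1 / (a * b)"
      unfolding k using that(8,9) by simp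
    ultimately show ?thesis by simp
  qed
  have f: "fact (Suc r + J) = ((of_nat r + of_nat J + 1) * fact (r + J) :: rat)"
    "fact (r + Suc J) = ((of_nat r + of_nat J + 1) * fact (r + J) :: rat)"
    "fact (Suc d) = (of_nat (Suc d) * fact d :: rat)"
    "fact (Suc J) = (of_nat (Suc J) * fact J :: rat)"
    "of_nat (r * Suc r) = (of_nat r * (of_nat r + 1) :: rat)"
    "(-1) ^ Suc J = (- ((-1) ^ J) :: rat)"
    by (simp_all add: algebra_simps)
  have "(\<Sum>j<Suc J. (-1) ^ j * fact (Suc r + j) / (fact (r - j) * fact j * fact (Suc j)))
      + (\<Sum>j<Suc J. (-1) ^ j * fact (r + j) / (fact (r - Suc j) * fact j * fact (Suc j)))
     = - ((-1) ^ J * of_nat (2 * r + 1) * of_nat J * fact (r + J)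
        / (fact (Suc d) * (fact J)\<^sup>2 * of_nat (r * Suc r)))
      + (-1) ^ J * fact (Suc r + J) / (fact (Suc d) * fact J * fact (Suc J))
      + (-1) ^ J * fact (r + J) / (fact d * fact J * fact (Suc J) :: rat)"
    using Suc by (simp add: r(2,3) del: fact_Suc of_nat_Suc)
  also have "\<dots> = - ((-1) ^ Suc J * of_nat (2 * r + 1) * of_nat (Suc J) * fact (r + Suc J)
        / (fact d * (fact (Suc J))\<^sup>2 * of_nat (r * Suc r)))"
    unfolding f
  proof (rule gen)
    show "of_nat r = of_nat J + (of_nat (Suc d) :: rat)" by (simp add: r(1))
    show "of_nat r + 1 \<noteq> (0 :: rat)" using of_nat_neq_0[of r, where 'a = rat] by (simp add: add.commute)
    show "of_nat (Suc J) = of_nat J + (1 :: rat)" by simp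
    show "of_nat (2 * r + 1) = 2 * of_nat r + (1 :: rat)" by simp
  qed (use assms(1) in \<open>simp_all del: of_nat_Suc\<close>)
  finally show ?case by (simp only: r(3))
qed simp

text \<open>\<open>alternating_sum_step\<close> at \<open>J = r\<close> evaluates the sums for
  \<open>r + 1\<close> and \<open>r\<close> together, without the last term for
  \<open>r + 1\<close>. That term cancels the closed form, so consecutive sums are opposite.\<close>

lemma alternating_sum:
  assumes "0 < i"
  shows "(\<Sum>j<i. (-1) ^ j * fact (i + j) / (fact (i - Suc j) * fact j * fact (Suc j))) = (- ((-1) ^ i) :: rat)"
  using assms
proof (induction i rule: nat_induct_non_zero)
  case (Suc r)
  have "(\<Sum>j<Suc r. (-1) ^ j * fact (Suc r + j) / (fact (Suc r - Suc j) * fact j * fact (Suc j)))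
     = (\<Sum>j<r. (-1) ^ j * fact (Suc r + j) / (fact (r - j) * fact j * fact (Suc j)))
       + (-1) ^ r * fact (Suc r + r) / (fact r * fact (Suc r) :: rat)"
    by (simp del: fact_Suc)
  also have "(-1) ^ r * fact (Suc r + r) / (fact r * fact (Suc r) :: rat)
      = (-1) ^ r * of_nat (2 * r + 1) * of_nat r * fact (r + r) / (fact (r - r) * (fact r)\<^sup>2 * of_nat (r * Suc r))"
  proof -
    have gen: "s * (t * F) / (f * (b * f)) = s * t * R * F / (1 * f\<^sup>2 * (R * b))"
      if "R \<noteq> 0" for s t F f b R :: rat
      using that by (simp add: power2_eq_square)
    have f: "fact (Suc r + r) = (of_nat (2 * r + 1) * fact (r + r) :: rat)"
      "fact (Suc r) = (of_nat (Suc r) * fact r :: rat)" "fact (r - r) = (1 :: rat)"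
      by simp_all
    show ?thesis unfolding f of_nat_mult[of r "Suc r"] by (rule gen) (use Suc.hyps in simp)
  qed
  also have "(\<Sum>j<r. (-1) ^ j * fact (Suc r + j) / (fact (r - j) * fact j * fact (Suc j))) + \<dots>
      = - (\<Sum>j<r. (-1) ^ j * fact (r + j) / (fact (r - Suc j) * fact j * fact (Suc j)))"
    using alternating_sum_step[OF Suc.hyps order_refl] by linarith
  finally show ?case using Suc.IH by simp
qed simp

text \<open>By \<open>coeff_sq_prod\<close> its coefficient of \<open>y ^ 2\<close> is the sum of
  \<open>nested2 (k - 1) / k\<close> for \<open>k\<close> from 1 to \<open>N\<close>.\<close>

definition harmonic_poly :: "nat \<Rightarrow> rat poly" where
  "harmonic_poly N = (\<Sum>k<N. smult (1 / of_nat (Suc k)) (sq_prod k))"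

definition central_poly :: "nat \<Rightarrow> rat poly" where
  "central_poly N = (\<Sum>k<N. smult (1 / (of_nat (Suc k) ^ 2 * of_nat ((2 * Suc k) choose Suc k))) (sq_prod k))"

text \<open>At \<open>i ^ 2\<close> all products with \<open>k >= i\<close> have a zero factor, so
  the value does not depend on \<open>N\<close>.\<close>

lemma poly_sum_sq_prod:
  assumes "1 \<le> i" "i \<le> N"
  shows "poly (\<Sum>k<N. smult (a k) (sq_prod k)) (of_nat i ^ 2)
    = (\<Sum>k<i. a k * ((-1) ^ k * fact (i + k) / (of_nat i * fact (i - Suc k) * (fact k)\<^sup>2)))"
proof -
  have "poly (\<Sum>k<N. smult (a k) (sq_prod k)) (of_nat i ^ 2) = (\<Sum>k<N. a k * poly (sq_prod k) (of_nat i ^ 2))"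
    by (simp add: poly_sum)
  also have "\<dots> = (\<Sum>k<i. a k * poly (sq_prod k) (of_nat i ^ 2))"
    by (rule sum.mono_neutral_right) (use assms in \<open>auto simp: poly_sq_prod_square_0\<close>)
  also have "\<dots> = (\<Sum>k<i. a k * ((-1) ^ k * fact (i + k) / (of_nat i * fact (i - Suc k) * (fact k)\<^sup>2)))"
    by (intro sum.cong refl) (simp add: poly_sq_prod_square)
  finally show ?thesis .
qed

lemma poly_harmonic_poly:
  assumes "1 \<le> i" "i \<le> N"
  shows "poly (harmonic_poly N) (of_nat i ^ 2) = - ((-1) ^ i) / of_nat i"
proof -
  have "poly (harmonic_poly N) (of_nat i ^ 2)
    = (\<Sum>k<i. (-1) ^ k * fact (i + k) / (fact (i - Suc k) * fact k * fact (Suc k))) / of_nat i"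
    unfolding harmonic_poly_def poly_sum_sq_prod[OF assms] sum_divide_distrib
    by (intro sum.cong refl) (simp add: power2_eq_square mult_ac)
  also have "\<dots> = - ((-1) ^ i) / of_nat i"
    using assms by (subst alternating_sum) simp_all
  finally show ?thesis .
qed

section \<open>Values of \<open>central_poly\<close> at squares: a sequence of period 6\<close>

definition alt_binomial_sum :: "nat \<Rightarrow> rat" where
  "alt_binomial_sum i = (\<Sum>n\<le>i. (-1) ^ n * of_nat ((i + n) choose (2 * n)))"

lemma alt_binomial_sum_extend:
  "i \<le> M \<Longrightarrow> alt_binomial_sum i = (\<Sum>n\<le>M. (-1) ^ n * of_nat ((i + n) choose (2 * n)))"
  unfolding alt_binomial_sum_def by (rule sum.mono_neutral_left) auto

text \<open>Repeated use of Pascal's rule gives a termwise relation. The sums are first extended by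
  zero terms, so that the term with shifted index again adds up to an
  \<open>alt_binomial_sum\<close>.\<close>

lemma alt_binomial_sum_rec:
  "alt_binomial_sum (Suc (Suc i)) = alt_binomial_sum (Suc i) - alt_binomial_sum i"
proof -
  define M where "M = Suc i"
  define c where "c i n = (-1) ^ n * (of_nat ((i + n) choose (2 * n)) :: rat)" for i n
  have c: "c (Suc (Suc i)) (Suc n) = 2 * c (Suc i) (Suc n) - c i (Suc n) - c (Suc i) n" for n
  proof -
    define m where "m = Suc (i + n)"
    have "(Suc (Suc m) choose Suc (Suc (2 * n))) + (m choose Suc (Suc (2 * n)))
      = 2 * (Suc m choose Suc (Suc (2 * n))) + (m choose (2 * n))"
      by simp
    then have "(of_nat (Suc (Suc m) choose Suc (Suc (2 * n))) + of_nat (m choose Suc (Suc (2 * n))) :: rat)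
      = 2 * of_nat (Suc m choose Suc (Suc (2 * n))) + of_nat (m choose (2 * n))"
      by (metis of_nat_add of_nat_mult of_nat_numeral)
    then have "(of_nat (Suc (Suc m) choose Suc (Suc (2 * n))) :: rat)
      = 2 * of_nat (Suc m choose Suc (Suc (2 * n))) + of_nat (m choose (2 * n)) - of_nat (m choose Suc (Suc (2 * n)))"
      by linarith
    moreover have "Suc (Suc i) + Suc n = Suc (Suc m)" "Suc i + Suc n = Suc m" "i + Suc n = m" "Suc i + n = m"
      "2 * Suc n = Suc (Suc (2 * n))"
      by (simp_all add: m_def)
    ultimately show ?thesis
      unfolding c_def by (simp only:) (simp add: algebra_simps)
  qed
  have c0: "c j 0 = 1" for j by (simp add: c_def)
  have e: "alt_binomial_sum (Suc (Suc i)) = (\<Sum>n\<le>Suc M. c (Suc (Suc i)) n)"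
    "alt_binomial_sum (Suc i) = (\<Sum>n\<le>Suc M. c (Suc i) n)" "alt_binomial_sum i = (\<Sum>n\<le>Suc M. c i n)"
    "(\<Sum>n\<le>M. c (Suc i) n) = alt_binomial_sum (Suc i)"
    unfolding c_def
    by (intro alt_binomial_sum_extend alt_binomial_sum_extend[symmetric]; simp add: M_def)+
  have "alt_binomial_sum (Suc (Suc i)) = 1 + (2 * (\<Sum>n\<le>M. c (Suc i) (Suc n)) - (\<Sum>n\<le>M. c i (Suc n))
      - alt_binomial_sum (Suc i))"
    unfolding e(1) sum.atMost_Suc_shift c c0 e(4)[symmetric] sum_subtractf sum_distrib_left ..
  moreover have "alt_binomial_sum (Suc i) = 1 + (\<Sum>n\<le>M. c (Suc i) (Suc n))"
    "alt_binomial_sum i = 1 + (\<Sum>n\<le>M. c i (Suc n))"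
    unfolding e(2,3) sum.atMost_Suc_shift c0 by (rule refl)+
  ultimately show ?thesis by linarith
qed

text \<open>\<open>two_cos i\<close> is \<open>2 cos (\<pi> i / 3)\<close>.\<close>

definition two_cos :: "nat \<Rightarrow> rat" where
  "two_cos i = [2, 1, -1, -2, -1, 1] ! (i mod 6)"

text \<open>The recurrence has characteristic polynomial \<open>x ^ 2 - x + 1\<close>, whose roots
  are the primitive sixth roots of unity. The values are
  \<open>cos ((2 * i + 1) * pi / 6) / cos (pi / 6)\<close>.\<close>

lemma alt_binomial_sum_eq: "alt_binomial_sum i = [1, 0, -1, -1, 0, 1] ! (i mod 6)"
proof (induction i rule: induct_nat_012)
  case (ge2 i)
  have "i mod 6 = 0 \<or> i mod 6 = 1 \<or> i mod 6 = 2 \<or> i mod 6 = 3 \<or> i mod 6 = 4 \<or> i mod 6 = 5" by linarith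
  with ge2 show ?case
    unfolding alt_binomial_sum_rec by (auto simp: mod_Suc)
qed (simp_all add: alt_binomial_sum_def numeral_2_eq_2)

lemma two_cos_Suc: "two_cos (Suc i) = alt_binomial_sum (Suc i) + alt_binomial_sum i"
proof -
  have "i mod 6 = 0 \<or> i mod 6 = 1 \<or> i mod 6 = 2 \<or> i mod 6 = 3 \<or> i mod 6 = 4 \<or> i mod 6 = 5" by linarith
  then show ?thesis
    unfolding alt_binomial_sum_eq two_cos_def by (auto simp: mod_Suc)
qed

text \<open>Since \<open>(i + (k + 1)) + (i - (k + 1)) = 2 * i\<close>, each summand splits into two
  binomial coefficients with upper entries \<open>i + k + 1\<close> and \<open>i + k\<close>. They
  sum to \<open>alt_binomial_sum\<close> at \<open>i\<close> and \<open>i - 1\<close>, which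
  together make \<open>two_cos i\<close>.\<close>

lemma poly_central_poly:
  assumes "1 \<le> i" "i \<le> N"
  shows "poly (central_poly N) (of_nat i ^ 2) = (1 - two_cos i / 2) / of_nat i ^ 2"
proof -
  obtain r where r: "i = Suc r" using assms by (cases i) auto
  have "poly (central_poly N) (of_nat i ^ 2)
    = (\<Sum>k<i. (-1) ^ k * fact (i + k) / (of_nat i * fact (i - Suc k) * fact (2 * Suc k)))"
    unfolding central_poly_def poly_sum_sq_prod[OF assms] of_nat_central_binomial
  proof (intro sum.cong refl)
    fix k
    have gen: "1 / (K\<^sup>2 * (D / (K * f)\<^sup>2)) * (s * F / (I * g * f\<^sup>2)) = s * F / (I * g * D)"
      if "K \<noteq> 0" "f \<noteq> 0" for K D f s F I g :: rat
      using that by (simp add: power2_eq_square)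
    show "1 / (of_nat (Suc k) ^ 2 * (fact (2 * Suc k) / (fact (Suc k))\<^sup>2))
        * ((-1) ^ k * fact (i + k) / (of_nat i * fact (i - Suc k) * (fact k)\<^sup>2))
      = (-1) ^ k * fact (i + k) / (of_nat i * fact (i - Suc k) * fact (2 * Suc k) :: rat)"
      unfolding fact_Suc[of k] by (rule gen) (simp_all del: of_nat_Suc)
  qed
  also have "\<dots> = (\<Sum>k<i. - ((-1) ^ Suc k * of_nat ((Suc r + Suc k) choose (2 * Suc k))
      + (-1) ^ Suc k * of_nat ((r + Suc k) choose (2 * Suc k))) / (2 * of_nat i ^ 2))"
  proof (intro sum.cong refl)
    fix k assume "k \<in> {..<i}"
    define d where "d = r - k"
    have d: "r = k + d" using \<open>k \<in> {..<i}\<close> by (simp add: d_def r)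
    have D: "i - Suc k = d" by (simp add: r d)
    have F: "fact (Suc r + Suc k) = ((of_nat i + of_nat (Suc k)) * fact (i + k) :: rat)"
      by (simp add: r)
    have 1: "of_nat ((Suc r + Suc k) choose (2 * Suc k)) = ((of_nat i + of_nat (Suc k)) * fact (i + k) / (fact (2 * Suc k) * fact d) :: rat)"
    proof -
      have "Suc r + Suc k - 2 * Suc k = d" by (simp add: d)
      then show ?thesis
        using binomial_fact[of "2 * Suc k" "Suc r + Suc k", where ?'a = rat] unfolding F by (simp add: d del: fact_Suc)
    qed
    have 2: "of_nat ((r + Suc k) choose (2 * Suc k)) = ((of_nat i - of_nat (Suc k)) * fact (i + k) / (fact (2 * Suc k) * fact d) :: rat)"
    \<comment> \<open>For \<open>d = 0\<close>, that is \<open>k = i - 1\<close>, the binomial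
      coefficient is out of range and the factor \<open>i - (k + 1)\<close> vanishes as
      well.\<close>
    proof (cases d)
      case 0
      then show ?thesis by (simp add: r d binomial_eq_0)
    next
      case (Suc e)
      have le: "2 * Suc k \<le> r + Suc k" by (simp add: d Suc)
      have e: "r + Suc k - 2 * Suc k = e" by (simp add: d Suc)
      have i: "r + Suc k = i + k" by (simp add: r)
      have m: "of_nat i - of_nat (Suc k) = (of_nat (Suc e) :: rat)" by (simp add: r d Suc)
      show ?thesis
        unfolding binomial_fact[OF le] e m Suc unfolding i fact_Suc[of e]
        by (simp del: fact_Suc of_nat_Suc)
    qed
    have gen: "s * F / (I * g * D) = - (- s * ((I + K) * F / (D * g)) + - s * ((I - K) * F / (D * g))) / (2 * I\<^sup>2)"
      if "I \<noteq> 0" for s F I g D K :: rat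
    proof -
      define y where "y = F / (D * g)"
      have "- (- s * ((I + K) * y) + - s * ((I - K) * y)) = 2 * I * (s * y)"
        by (simp add: algebra_simps)
      moreover have "s * F / (I * g * D) = 2 * I * (s * y) / (2 * I\<^sup>2)"
        using that by (simp add: y_def power2_eq_square mult_ac)
      ultimately show ?thesis by (simp add: y_def)
    qed
    have s: "(-1 :: rat) ^ Suc k = - ((-1) ^ k)" by simp
    show "(-1) ^ k * fact (i + k) / (of_nat i * fact (i - Suc k) * fact (2 * Suc k) :: rat)
      = - ((-1) ^ Suc k * of_nat ((Suc r + Suc k) choose (2 * Suc k))
        + (-1) ^ Suc k * of_nat ((r + Suc k) choose (2 * Suc k))) / (2 * of_nat i ^ 2)"
      unfolding 1 2 D s by (rule gen) (simp add: r del: of_nat_Suc)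
  qed
  also have "\<dots> = - ((\<Sum>k<i. (-1) ^ Suc k * of_nat ((Suc r + Suc k) choose (2 * Suc k)))
      + (\<Sum>k<i. (-1) ^ Suc k * of_nat ((r + Suc k) choose (2 * Suc k)))) / (2 * of_nat i ^ 2)"
    by (simp only: sum.distrib sum_negf sum_divide_distrib[symmetric])
  also have "(\<Sum>k<i. (-1) ^ Suc k * of_nat ((Suc r + Suc k) choose (2 * Suc k))) = alt_binomial_sum (Suc r) - 1"
    unfolding alt_binomial_sum_extend[OF order_refl] sum.atMost_Suc_shift r lessThan_Suc_atMost by simp
  also have "(\<Sum>k<i. (-1) ^ Suc k * of_nat ((r + Suc k) choose (2 * Suc k))) = alt_binomial_sum r - 1"
    unfolding alt_binomial_sum_extend[of r "Suc r", OF le_SucI[OF order_refl]] sum.atMost_Suc_shift r lessThan_Suc_atMost by simp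
  also have "- (alt_binomial_sum (Suc r) - 1 + (alt_binomial_sum r - 1)) = 2 * (1 - two_cos i / 2)"
    unfolding r two_cos_Suc by (simp add: field_simps)
  also have "2 * (1 - two_cos i / 2) / (2 * of_nat i ^ 2) = (1 - two_cos i / 2) / of_nat i ^ 2"
    by (rule mult_divide_mult_cancel_left) simp
  finally show ?thesis .
qed

section \<open>Factorials and harmonic sums modulo a prime\<close>

text \<open>Newton's identity between power sums and elementary symmetric functions; it yields
  \<open>nested2 (p - 1)\<close> modulo \<open>p\<close> from two power sums.\<close>

lemma harmonic2_square: "harmonic2 n ^ 2 = 2 * nested2 n + (\<Sum>k=1..n. 1 / of_nat k ^ 4)"
proof (induction n)
  case (Suc n)
  have "(harmonic2 n + x) ^ 2 = harmonic2 n ^ 2 + 2 * (harmonic2 n * x) + x ^ 2" for x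
    by (simp add: power2_eq_square algebra_simps)
  then have "harmonic2 (Suc n) ^ 2
      = harmonic2 n ^ 2 + 2 * (harmonic2 n / of_nat (Suc n) ^ 2) + 1 / of_nat (Suc n) ^ 4"
    by (simp add: power_divide del: of_nat_Suc flip: power_mult)
  then show ?case unfolding Suc by (simp add: algebra_simps del: of_nat_Suc)
qed simp

context p_local
begin

lemma p_cong_power:
  assumes "x \<in> Zp" "y \<in> Zp" "p_cong e x y"
  shows "p_cong e (x ^ n) (y ^ n)"
proof (induction n)
  case (Suc n)
  then show ?case unfolding power_Suc using assms by (intro p_cong_mult Zp_power)
qed simp

lemma Zp_one_divide: "0 < n \<Longrightarrow> n < p \<Longrightarrow> 1 / of_nat n ^ s \<in> Zp"
  by (intro Zp_divide_power Zp_1 not_dvd_less)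

text \<open>Substituting \<open>p - k\<close> for \<open>k\<close> turns the head of the sum into a
  tail, and the complete sum vanishes modulo \<open>p\<close>.\<close>

lemma harmonic_reflect:
  assumes "0 < s" "s < p - 1" "i < p"
  shows "p_cong (Suc 0) (\<Sum>k=1..p-1-i. 1 / of_nat k ^ s) (- ((-1) ^ s) * (\<Sum>k=1..i. 1 / of_nat k ^ s))"
proof -
  have "(\<Sum>k=1..p-1-i. 1 / of_nat k ^ s :: rat) = (\<Sum>k=Suc i..p-1. 1 / of_nat (p - k) ^ s)"
    by (rule sum.reindex_bij_witness[of _ "\<lambda>k. p - k" "\<lambda>k. p - k"]) (use assms in auto)
  also have "p_cong (Suc 0) \<dots> (\<Sum>k=Suc i..p-1. (-1) ^ s / of_nat k ^ s)"
    using p_pos by (intro p_cong_sum p_cong_inverse_reflect) auto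
  also have "\<dots> = (-1) ^ s * ((\<Sum>k=1..p-1. 1 / of_nat k ^ s) - (\<Sum>k=1..i. 1 / of_nat k ^ s))"
  proof -
    have "{1..p-1} = {1..i} \<union> {Suc i..p-1}" using assms by auto
    then have "(\<Sum>k=1..p-1. 1 / of_nat k ^ s :: rat) = (\<Sum>k=1..i. 1 / of_nat k ^ s) + (\<Sum>k=Suc i..p-1. 1 / of_nat k ^ s)"
      by (simp add: sum.union_disjoint)
    then show ?thesis by (simp add: sum_distrib_left)
  qed
  also have "p_cong (Suc 0) \<dots> ((-1) ^ s * (0 - (\<Sum>k=1..i. 1 / of_nat k ^ s)))"
    using assms by (intro p_cong_mult_left p_cong_diff harmonic_power_cong_0 p_cong_refl Zp_power Zp_uminus Zp_1)
  finally show ?thesis by simp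
qed

section \<open>Factorials and central binomial coefficients with one factor \<open>p\<close>\<close>

lemma fact_p_add:
  assumes "m < p"
  shows "\<exists>u. fact (p + m) = p * u \<and> \<not> p dvd u \<and> p_cong (Suc 0) (of_nat u) (- (fact m))"
  using assms
proof (induction m)
  case 0
  \<comment> \<open>The witness \<open>u\<close> is the product of all factors of
    \<open>fact (p + m)\<close> other than \<open>p\<close>; for \<open>m = 0\<close> Wilson's
    theorem evaluates it.\<close>
  have "fact p = p * fact (p - 1)" using p_pos by (simp add: fact_reduce)
  moreover have "\<not> p dvd fact (p - 1)" using p_pos by (intro not_dvd_fact) simp
  ultimately show ?case using p_cong_wilson by (intro exI[of _ "fact (p - 1)"]) simp
next
  case (Suc m)
  then obtain u where u: "fact (p + m) = p * u" "\<not> p dvd u" "p_cong (Suc 0) (of_nat u) (- (fact m))"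
    by auto
  have "fact (p + Suc m) = p * ((p + Suc m) * u)" using u(1) by (simp add: algebra_simps)
  moreover have "\<not> p dvd p + Suc m" 
    unfolding dvd_add_triv_left_iff using Suc.prems by (intro not_dvd_less) simp_all
  then have "\<not> p dvd (p + Suc m) * u" using u(2) by (simp only: prime_dvd_mult_iff[OF prime_p]) simp
  moreover have "p_cong (Suc 0) (of_nat (p + Suc m) * of_nat u) (of_nat (Suc m) * - (fact m))"
    unfolding of_nat_add by (intro p_cong_mult u(3) p_cong_p_minus Zp_add Zp_uminus Zp_fact Zp_of_nat)
  then have "p_cong (Suc 0) (of_nat ((p + Suc m) * u)) (- (fact (Suc m)))"
    by (simp only: of_nat_mult fact_Suc mult_minus_right)
  ultimately show ?case by blast
qed

lemma p_div_fact:
  assumes "m < p"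
  shows "p_cong (Suc 0) (of_nat p / fact (p + m)) (- (1 / fact m))"
proof -
  obtain u where u: "fact (p + m) = p * u" "\<not> p dvd u" "p_cong (Suc 0) (of_nat u) (- (fact m))"
    using fact_p_add[OF assms] by auto
  have u0: "u \<noteq> 0" using u(2) by (intro notI) simp
  have "(fact (p + m) :: rat) = of_nat p * of_nat u"
    by (metis u(1) of_nat_fact of_nat_mult)
  then have "of_nat p / fact (p + m) = (1 / of_nat u :: rat)"
    using p_pos by simp
  moreover have "p_cong (Suc 0) (1 / fact m) (- (1 / of_nat u))"
    using p_cong_divide[OF not_dvd_fact[OF assms] p_cong_divide[OF u(2) u(3)]] u0 by simp
  then have "p_cong (Suc 0) (1 / of_nat u) (- (1 / fact m))"
    using p_cong_uminus p_cong_sym by fastforce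
  ultimately show ?thesis by simp
qed

lemma p_div_fact_Zp: "m < p \<Longrightarrow> of_nat p / fact (p + m) \<in> Zp"
  by (rule p_cong_Zp[OF p_div_fact]) (auto intro!: Zp_uminus Zp_divide_fact)

lemma inverse_central_binomial_Zp:
  assumes "2 * n < p"
  shows "1 / of_nat ((2 * n) choose n) \<in> Zp"
proof -
  have "1 / of_nat ((2 * n) choose n) = ((fact n)\<^sup>2 / fact (2 * n) :: rat)"
    unfolding of_nat_central_binomial by simp
  also have "\<dots> \<in> Zp" using assms by (intro Zp_divide_fact Zp_power Zp_fact)
  finally show ?thesis .
qed

text \<open>Since \<open>2 * n < 2 * p\<close>, the prime \<open>p\<close> divides
  \<open>fact (2 * n)\<close> at most once.\<close>

lemma p_div_central_binomial_Zp:
  assumes "n < p"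
  shows "of_nat p / of_nat ((2 * n) choose n) \<in> Zp"
proof (cases "2 * n < p")
  case True
  then show ?thesis
    using Zp_mult[OF Zp_of_nat inverse_central_binomial_Zp[OF True], of p] by simp
next
  case False
  define m where "m = 2 * n - p"
  have m: "2 * n = p + m" "m < p" using False assms by (simp_all add: m_def)
  have "of_nat p / of_nat ((2 * n) choose n) = (fact n)\<^sup>2 * (of_nat p / fact (p + m) :: rat)"
    unfolding of_nat_central_binomial by (simp add: m(1))
  also have "\<dots> \<in> Zp" using m(2) by (intro Zp_mult Zp_power Zp_fact p_div_fact_Zp)
  finally show ?thesis .
qed

text \<open>With \<open>m = p - 2 * j\<close> the quotient is
  \<open>fact (p - j) ^ 2 * (p / fact (p + m))\<close>. Its last factor is
  \<open>- 1 / fact m\<close>, and reflection expresses everything by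
  \<open>fact (2 * j - 1)\<close> and \<open>fact (j - 1)\<close>, which form a central binomial
  coefficient again.\<close>

lemma p_div_central_binomial_reflect:
  assumes "0 < j" "2 * j < p"
  shows "p_cong (Suc 0) (of_nat p / of_nat ((2 * p - 2 * j) choose (p - j)))
    (- (of_nat j * of_nat ((2 * j) choose j) / 2))"
proof -
  define m where "m = p - 2 * j"
  obtain i where i: "j = Suc i" using assms by (cases j) auto
  have m: "2 * (p - j) = p + m" "m < p" "2 * p - 2 * j = 2 * (p - j)" using assms by (simp_all add: m_def)
  have F: "p_cong (Suc 0) (fact (p - j)) ((-1) ^ j / fact i)"
  proof (rule p_cong_mult_cancel[of "fact i"])
    show "\<not> p dvd fact i" using assms by (intro not_dvd_fact) (simp add: i)
    show "p_cong (Suc 0) (of_nat (fact i) * fact (p - j)) (of_nat (fact i) * ((-1) ^ j / fact i))"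
      using p_cong_fact_reflect[of i] assms by (simp add: i mult.commute)
  qed
  have G: "p_cong (Suc 0) (1 / fact m) (fact (2 * j - 1))"
  proof (rule p_cong_mult_cancel[of "fact m"])
    show "\<not> p dvd fact m" using m(2) by (rule not_dvd_fact)
    have "p - 1 - (2 * j - 1) = m" "Suc (2 * j - 1) = 2 * j" using assms by (simp_all add: m_def)
    then show "p_cong (Suc 0) (of_nat (fact m) * (1 / fact m)) (of_nat (fact m) * fact (2 * j - 1))"
      using p_cong_sym[OF p_cong_fact_reflect[of "2 * j - 1"]] assms by simp
  qed
  have i_p: "i < p" using assms by (simp add: i)
  have "of_nat p / of_nat ((2 * p - 2 * j) choose (p - j)) = (fact (p - j))\<^sup>2 * (of_nat p / fact (p + m) :: rat)"
    unfolding m(3) of_nat_central_binomial by (simp add: m(1))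
  also have "p_cong (Suc 0) \<dots> (((-1) ^ j / fact i)\<^sup>2 * - (fact (2 * j - 1)))"
  proof (rule p_cong_mult)
    show "p_cong (Suc 0) ((fact (p - j))\<^sup>2) (((-1) ^ j / fact i)\<^sup>2)"
      using i_p by (intro p_cong_power F Zp_fact Zp_divide_fact Zp_power Zp_uminus Zp_1)
    show "p_cong (Suc 0) (of_nat p / fact (p + m)) (- (fact (2 * j - 1)))"
      by (rule p_cong_trans[OF p_div_fact[OF m(2)] p_cong_uminus[OF G]])
  qed (auto intro!: Zp_power Zp_uminus)
  also have "((-1) ^ j / fact i)\<^sup>2 * - (fact (2 * j - 1)) = - (of_nat j * of_nat ((2 * j) choose j) / 2 :: rat)"
  proof -
    have f: "(fact (2 * j) :: rat) = 2 * of_nat j * fact (2 * j - 1)" "(fact j :: rat) = of_nat j * fact i"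
      using assms fact_reduce[of "2 * j", where 'a = rat] by (simp_all add: i)
    have "((-1 :: rat) ^ j)\<^sup>2 = 1" by (simp flip: power_mult)
    then show ?thesis
      unfolding of_nat_central_binomial f power_divide using assms(1) by (simp add: power2_eq_square)
  qed
  finally show ?thesis .
qed

text \<open>Holds term by term by \<open>p_div_central_binomial_reflect\<close>: the factor
  \<open>- 2\<close> cancels the \<open>- 1 / 2\<close> there, and one power of \<open>j\<close> is
  absorbed.\<close>

lemma central_sum_cong_reflected:
  fixes f :: "nat \<Rightarrow> rat"
  assumes "3 < p" "\<And>j. j \<in> {1..(p - 1) div 2} \<Longrightarrow> f j \<in> Zp"
  shows "p_cong (Suc 0) (\<Sum>j=1..(p - 1) div 2. of_nat ((2 * j) choose j) / of_nat j ^ 3 * f j)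
    (- 2 * (\<Sum>j=1..(p - 1) div 2. of_nat p / (of_nat j ^ 4 * of_nat ((2 * p - 2 * j) choose (p - j))) * f j))"
  unfolding sum_distrib_left
proof (rule p_cong_sum)
  fix j assume j: "j \<in> {1..(p - 1) div 2}"
  then have j': "0 < j" "2 * j < p" using assms(1) by auto
  have nd: "\<not> p dvd j" using j' by (intro not_dvd_less) auto
  define C :: rat where "C = of_nat p / of_nat ((2 * p - 2 * j) choose (p - j))"
  have "- 2 * (of_nat p / (of_nat j ^ 4 * of_nat ((2 * p - 2 * j) choose (p - j))) * f j)
      = - 2 * (f j * (C / of_nat j ^ 4))"
    by (simp add: C_def mult_ac)
  also have "p_cong (Suc 0) \<dots> (- 2 * (f j * (- (of_nat j * of_nat ((2 * j) choose j) / 2) / of_nat j ^ 4)))"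
    unfolding C_def using assms(2)[OF j] nd j'
    by (intro p_cong_mult_left p_cong_divide_power p_div_central_binomial_reflect Zp_uminus Zp_numeral)
  also have "\<dots> = of_nat ((2 * j) choose j) / of_nat j ^ 3 * f j"
    using j'(1) by (simp add: power3_eq_cube power4_eq_xxxx mult_ac)
  finally show "p_cong (Suc 0) (of_nat ((2 * j) choose j) / of_nat j ^ 3 * f j)
      (- 2 * (of_nat p / (of_nat j ^ 4 * of_nat ((2 * p - 2 * j) choose (p - j))) * f j))"
    by (rule p_cong_sym)
qed

lemma harmonic2_Zp: "n < p \<Longrightarrow> harmonic2 n \<in> Zp"
  unfolding harmonic2_def by (intro Zp_sum Zp_one_divide) auto

lemma nested2_Zp: "n < p \<Longrightarrow> nested2 n \<in> Zp"
  unfolding nested2_def by (intro Zp_sum Zp_divide_power harmonic2_Zp not_dvd_less) auto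

end

section \<open>Interpolation weights modulo \<open>p ^ 2\<close>\<close>

definition harmonic1 :: "nat \<Rightarrow> rat" where
  "harmonic1 n = (\<Sum>k=1..n. 1 / of_nat k)"

context p_local
begin

text \<open>For \<open>0 < i < p\<close> this is \<open>- p * weight (p - 1) i / (2 * i)\<close>.
  The factor \<open>p\<close> cancels the one in \<open>fact (p - 1 + i)\<close>, and what remains
  is the product of \<open>1 - p / m\<close> for \<open>m <= i\<close> over the product of
  \<open>1 + p / m\<close> for \<open>m < i\<close>.\<close>

definition theta :: "nat \<Rightarrow> rat" where
  "theta i = (-1) ^ i * of_nat p * (fact (p - 1))\<^sup>2 / (of_nat i * (fact (p - 1 - i) * fact (p - 1 + i)))"

lemma p_mult_weight: "0 < i \<Longrightarrow> of_nat p * weight (p - 1) i = - 2 * of_nat i * theta i"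
  by (simp add: weight_def theta_def)

lemma theta_1: "theta 1 = 1 - of_nat p"
proof -
  have "p \<ge> 2" using prime_p by (rule prime_ge_2_nat)
  then obtain r where r: "p = Suc (Suc r)" by (metis add_2_eq_Suc le_Suc_ex)
  have gen: "- 1 * P * (R * f)\<^sup>2 / (1 * (f * (P * (R * f)))) = - R" if "P \<noteq> 0" "R \<noteq> 0" "f \<noteq> 0" for P R f :: rat
    using that by (simp add: power2_eq_square)
  have e: "p - 1 = Suc r" "Suc r - 1 = r" "Suc r + 1 = Suc (Suc r)" by (simp_all add: r)
  have "theta 1 = - of_nat (Suc r)"
    unfolding theta_def e(1) unfolding e(2,3) fact_Suc r power_one_right of_nat_1 by (rule gen) (simp_all del: of_nat_Suc)
  then show ?thesis by (simp add: r)
qed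

lemma theta_Suc:
  assumes "0 < i" "Suc i < p"
  shows "of_nat (Suc i) * of_nat (p + i) * theta (Suc i) = of_nat i * (of_nat (Suc i) - of_nat p) * theta i"
proof -
  define d where "d = p - 1 - Suc i"
  have e: "p - 1 - Suc i = d" "p - 1 - i = Suc d" "p - 1 + Suc i = Suc (p - 1 + i)" "Suc (p - 1 + i) = p + i"
    using assms by (simp_all add: d_def)
  have p: "of_nat (Suc i) - of_nat p = (- of_nat (Suc d) :: rat)"
    using assms by (simp add: d_def of_nat_diff)
  have f: "fact (p - 1 + Suc i) = (of_nat (p + i) * fact (p - 1 + i) :: rat)"
    by (subst e(3), subst fact_Suc, subst e(4), rule refl)
  have gen: "S * Q * (- 1 * s * P * g / (S * (f * (Q * h)))) = I * - D * (s * P * g / (I * (D * f * h)))"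
    if "S \<noteq> 0" "Q \<noteq> 0" "I \<noteq> 0" "D \<noteq> 0" for S Q s P g f h I D :: rat
    using that by (simp add: mult_ac)
  show ?thesis
    unfolding theta_def p f e(1,2) fact_Suc[of d] power_Suc[of _ i]
    by (rule gen) (use assms p_pos in \<open>simp_all del: of_nat_Suc of_nat_add\<close>)
qed

lemma harmonic1_Zp: "n < p \<Longrightarrow> harmonic1 n \<in> Zp"
  unfolding harmonic1_def using Zp_one_divide[of _ 1] by (intro Zp_sum) simp

text \<open>The quotient of products that \<open>theta\<close> stands for, expanded to first order
  in \<open>p\<close>. The induction uses the ratio in \<open>theta_Suc\<close>, whose cleared
  denominator is prime to \<open>p\<close>.\<close>

lemma theta_cong:
  assumes "0 < i" "i < p"
  shows "p_cong 2 (theta i) (1 - of_nat p * (harmonic1 i + harmonic1 (i - 1)))"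
  using assms
proof (induction i rule: nat_induct_non_zero)
  case 1
  then show ?case using theta_1 by (simp add: harmonic1_def)
next
  case (Suc i)
  define x :: rat where "x = of_nat i"
  define P :: rat where "P = of_nat p"
  define h where "h = harmonic1 (i - 1)"
  have x0: "x \<noteq> 0" "x + 1 \<noteq> 0" using Suc.hyps unfolding x_def by auto
  have P0: "P \<noteq> 0" using p_pos by (simp add: P_def)
  have hi: "harmonic1 i = h + 1 / x"
    unfolding h_def harmonic1_def x_def using Suc.hyps by (cases i) simp_all
  have hSi: "harmonic1 (Suc i) = h + 1 / x + 1 / (x + 1)"
    unfolding hi[symmetric] by (simp add: harmonic1_def x_def add.commute)
  have Z: "h \<in> Zp" "x \<in> Zp" "P \<in> Zp" "1 / x \<in> Zp" "1 / (x + 1) \<in> Zp"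
    using Suc Zp_one_divide[of i 1] Zp_one_divide[of "Suc i" 1]
    by (auto simp: h_def x_def P_def harmonic1_Zp add.commute)
  have IH: "p_cong 2 (theta i) (1 - P * (h + 1 / x + h))"
    using Suc unfolding hi P_def h_def by simp
  have nd: "\<not> p dvd Suc i * (p + i)"
  proof -
    have "\<not> p dvd Suc i" "\<not> p dvd i"
      using Suc.hyps Suc.prems by (simp_all add: not_dvd_less)
    then show ?thesis by (simp only: prime_dvd_mult_iff[OF prime_p] dvd_add_triv_left_iff) simp
  qed
  have sn: "of_nat (Suc i * (p + i)) = (x + 1) * (P + x)"
    by (simp add: x_def P_def algebra_simps)
  have "of_nat (Suc i * (p + i)) * theta (Suc i) = x * (x + 1 - P) * theta i"
    unfolding sn using theta_Suc[of i] Suc by (simp add: x_def P_def add.commute)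
  also have "p_cong 2 \<dots> (x * (x + 1 - P) * (1 - P * (h + 1 / x + h)))"
    using Z by (intro p_cong_mult_left IH Zp_mult Zp_diff Zp_add Zp_1)
  also have "p_cong 2 \<dots> ((x + 1) * (P + x) * (1 - P * (h + 1 / x + 1 / (x + 1) + (h + 1 / x))))"
  proof -
    have "x * (x + 1 - P) * (1 - P * (h + u + h)) - (x + 1) * (P + x) * (1 - P * (h + u + v + (h + u)))
        = P\<^sup>2 * (x * (h + u + h) + (x + 1) * (h + u + v + (h + u)))"
      if "x * u = 1" "(x + 1) * v = 1" for u v
    proof -
      have "x * (x + 1 - P) * (1 - P * (h + u + h)) - (x + 1) * (P + x) * (1 - P * (h + u + v + (h + u)))
        - P\<^sup>2 * (x * (h + u + h) + (x + 1) * (h + u + v + (h + u)))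
        = P * ((x + 1) * (x * u) + x * ((x + 1) * v)) - P * x - P * (x + 1)"
        by (simp add: algebra_simps power2_eq_square)
      then show ?thesis unfolding that by (simp add: algebra_simps)
    qed
    from this[of "1 / x" "1 / (x + 1)"] x0
    have "x * (x + 1 - P) * (1 - P * (h + 1 / x + h)) - (x + 1) * (P + x) * (1 - P * (h + 1 / x + 1 / (x + 1) + (h + 1 / x)))
        = P\<^sup>2 * (x * (h + 1 / x + h) + (x + 1) * (h + 1 / x + 1 / (x + 1) + (h + 1 / x)))"
      by simp
    moreover have "x * (h + 1 / x + h) + (x + 1) * (h + 1 / x + 1 / (x + 1) + (h + 1 / x)) \<in> Zp"
      using Z by (intro Zp_mult Zp_diff Zp_add Zp_1)
    ultimately show ?thesis
      using P0 unfolding p_cong_def P_def[symmetric] by simp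
  qed
  also have "\<dots> = of_nat (Suc i * (p + i)) * (1 - P * (harmonic1 (Suc i) + harmonic1 i))"
    unfolding hSi hi sn ..
  finally show ?case
    using p_cong_mult_cancel[OF nd] unfolding P_def by simp
qed

lemma theta_Zp: assumes "0 < i" "i < p" shows "theta i \<in> Zp"
  by (rule p_cong_Zp[OF theta_cong[OF assms]]) (use assms in \<open>auto intro!: Zp_diff Zp_mult Zp_add harmonic1_Zp\<close>)

lemma theta_cong_1:
  assumes "0 < i" "i < p"
  shows "p_cong (Suc 0) (theta i) 1"
proof -
  have "p_cong (Suc 0) (theta i) (1 - of_nat p * (harmonic1 i + harmonic1 (i - 1)))"
    using theta_cong[OF assms] by (simp add: numeral_2_eq_2 p_cong_Suc)
  also have "p_cong (Suc 0) \<dots> (1 - 0)"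
    using assms by (intro p_cong_diff p_cong_refl p_cong_p_mult_0 Zp_add harmonic1_Zp) auto
  finally show ?thesis by simp
qed

text \<open>Reflection exchanges \<open>harmonic1 i\<close> and \<open>harmonic1 (i - 1)\<close>
  modulo \<open>p\<close>, and the first-order term of \<open>theta\<close> is symmetric in
  them.\<close>

lemma theta_reflect:
  assumes "3 < p" "0 < i" "i < p"
  shows "p_cong 2 (theta (p - i)) (theta i)"
proof -
  have H: "p_cong (Suc 0) (harmonic1 (p - 1 - k)) (harmonic1 k)" if "k < p" for k
    using harmonic_reflect[of 1 k] assms that by (simp add: harmonic1_def)
  have "p - 1 - (i - 1) = p - i" "p - 1 - i = p - i - 1" using assms by simp_all
  then have "p_cong (Suc 0) (harmonic1 (p - i) + harmonic1 (p - i - 1)) (harmonic1 (i - 1) + harmonic1 i)"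
    using p_cong_add[OF H[of "i - 1"] H[of i]] assms by simp
  then have "p_cong 2 (of_nat p * (harmonic1 (p - i) + harmonic1 (p - i - 1))) (of_nat p * (harmonic1 i + harmonic1 (i - 1)))"
    unfolding numeral_2_eq_2 p_cong_p_mult_iff by (simp add: add.commute)
  then have "p_cong 2 (1 - of_nat p * (harmonic1 (p - i) + harmonic1 (p - i - 1))) (1 - of_nat p * (harmonic1 i + harmonic1 (i - 1)))"
    by (intro p_cong_diff p_cong_refl)
  moreover have "p_cong 2 (theta (p - i)) (1 - of_nat p * (harmonic1 (p - i) + harmonic1 (p - i - 1)))"
    using assms by (intro theta_cong) auto
  ultimately show ?thesis
    using p_cong_sym[OF theta_cong[OF assms(2,3)]] p_cong_trans by blast
qed

text \<open>Modulo \<open>p ^ 2\<close>, \<open>1 / (p - i)\<close> is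
  \<open>- 1 / i - p / i ^ 2\<close>; its fourth power is taken to first order in
  \<open>p\<close>.\<close>

lemma inverse_power_4_reflect:
  assumes "0 < i" "i < p"
  shows "p_cong 2 (1 / of_nat (p - i) ^ 4) (1 / of_nat i ^ 4 + of_nat p * (4 / of_nat i ^ 5))"
proof -
  define u :: rat where "u = 1 / of_nat i"
  have u: "u \<in> Zp" using Zp_one_divide[of i 1] assms by (simp add: u_def)
  have v: "1 / of_nat (p - i) \<in> Zp" using Zp_one_divide[of "p - i" 1] assms by simp
  have "p_cong 2 (1 / of_nat (p - i)) (- u + of_nat p * (- (u\<^sup>2)))"
  proof -
    have i: "of_nat i \<noteq> (0 :: rat)" "of_nat (p - i) \<noteq> (0 :: rat)" "of_nat (p - i) = (of_nat p - of_nat i :: rat)"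
      using assms by (simp_all add: of_nat_diff)
    have "1 / y - (- u + P * (- (u\<^sup>2))) = P\<^sup>2 * (1 / y * u\<^sup>2)"
      if "y \<noteq> 0" "y = P - x" "u = 1 / x" "x \<noteq> 0" for x y P :: rat
      using that(1,4) unfolding that(3) by (simp add: divide_simps) (simp add: that(2) algebra_simps power2_eq_square)
    note E = this[OF i(2,3) u_def i(1)]
    have "1 / of_nat (p - i) * u\<^sup>2 \<in> Zp" using u v by (intro Zp_mult Zp_power)
    then show ?thesis
      unfolding p_cong_def E using p_pos by simp
  qed
  then have "p_cong 2 ((1 / of_nat (p - i)) ^ 4) ((- u + of_nat p * (- (u\<^sup>2))) ^ 4)"
    using u v by (intro p_cong_power Zp_add Zp_mult Zp_uminus Zp_power Zp_of_nat)
  also have "p_cong 2 \<dots> ((- u) ^ Suc 3 + of_nat (Suc 3) * of_nat p * (- (u\<^sup>2)) * (- u) ^ 3)"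
    using p_cong_power_add_p_mult[of "- u" "- (u\<^sup>2)" 3] u by (simp add: Zp_uminus Zp_power)
  also have "\<dots> = 1 / of_nat i ^ 4 + of_nat p * (4 / of_nat i ^ 5)"
    by (simp add: u_def power_divide divide_simps)
  finally show ?thesis by (simp add: power_divide)
qed

text \<open>Reflection flips the sign of \<open>(-1) ^ i\<close> because \<open>p\<close> is odd,
  while \<open>theta\<close> and \<open>1 / i ^ 4\<close> are preserved up to the correction
  \<open>4 * p / i ^ 5\<close>. Twice the sum is therefore the correction alone, in which
  \<open>theta\<close> may be replaced by 1.\<close>

lemma alternating_theta_sum:
  assumes "3 < p"
  shows "p_cong 2 (2 * (\<Sum>i=1..p-1. (-1) ^ i * theta i / of_nat i ^ 4))
    (of_nat p * (- 4 * (\<Sum>i=1..p-1. (-1) ^ i / of_nat i ^ 5)))"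
proof -
  define Y where "Y = (\<Sum>i=1..p-1. (-1) ^ i * theta i / of_nat i ^ 4)"
  define \<sigma> :: rat where "\<sigma> = (\<Sum>i=1..p-1. (-1) ^ i / of_nat i ^ 5)"
  have "odd p" using prime_p assms prime_odd_nat by simp
  have "Y = (\<Sum>i=1..p-1. (-1) ^ (p - i) * theta (p - i) / of_nat (p - i) ^ 4)"
    unfolding Y_def by (rule sum_reflect[symmetric])
  also have "\<dots> = (\<Sum>i=1..p-1. - ((-1) ^ i) * (theta (p - i) * (1 / of_nat (p - i) ^ 4)))"
    using \<open>odd p\<close> by (intro sum.cong refl) (auto simp: minus_one_power_iff)
  also have "p_cong 2 \<dots> (\<Sum>i=1..p-1. - ((-1) ^ i) * (theta i * (1 / of_nat i ^ 4 + of_nat p * (4 / of_nat i ^ 5))))"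
  proof (intro p_cong_sum p_cong_mult_left p_cong_mult)
    fix i assume "i \<in> {1..p-1}"
    then have i: "0 < i" "i < p" by auto
    show "theta (p - i) \<in> Zp" using i by (intro theta_Zp) auto
    show "1 / of_nat i ^ 4 + of_nat p * (4 / of_nat i ^ 5) \<in> Zp"
      using i by (intro Zp_add Zp_mult Zp_one_divide Zp_of_nat Zp_divide_power Zp_numeral not_dvd_less)
    show "p_cong 2 (theta (p - i)) (theta i)" using assms i by (rule theta_reflect)
    show "p_cong 2 (1 / of_nat (p - i) ^ 4) (1 / of_nat i ^ 4 + of_nat p * (4 / of_nat i ^ 5))"
      using i by (rule inverse_power_4_reflect)
  qed (auto intro!: Zp_uminus Zp_power)
  also have "\<dots> = - Y + of_nat p * (\<Sum>i=1..p-1. - 4 * ((-1) ^ i / of_nat i ^ 5 * theta i))"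
    unfolding Y_def sum_distrib_left sum_negf[symmetric] sum.distrib[symmetric]
    by (intro sum.cong refl) (simp add: algebra_simps)
  also have "p_cong 2 \<dots> (- Y + of_nat p * (\<Sum>i=1..p-1. - 4 * ((-1) ^ i / of_nat i ^ 5 * 1)))"
    unfolding numeral_2_eq_2
    by (intro p_cong_add p_cong_refl p_cong_p_mult_iff[THEN iffD2] p_cong_sum p_cong_mult_left theta_cong_1
        Zp_mult Zp_divide_power Zp_power Zp_uminus Zp_numeral Zp_1 not_dvd_less) auto
  also have "\<dots> = - Y + of_nat p * (- 4 * \<sigma>)"
    by (simp add: \<sigma>_def sum_distrib_left sum_negf)
  finally have "p_cong 2 (Y + Y) (Y + (- Y + of_nat p * (- 4 * \<sigma>)))"
    by (intro p_cong_add p_cong_refl)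
  then show ?thesis unfolding Y_def \<sigma>_def by simp
qed

text \<open>The power sums of exponents \<open>- 2\<close> and \<open>- 4\<close> vanish modulo
  \<open>p\<close>, hence so do \<open>harmonic2 (p - 1)\<close> and \<open>nested2 (p - 1)\<close>,
  and only the last sum of \<open>interpolation_coeff_2\<close> remains.\<close>

lemma coeff_2_cong:
  assumes "6 < p" "degree f < p - 1" "coeff f 0 \<in> Zp" "coeff f 1 \<in> Zp"
  shows "p_cong (Suc 0) (coeff f 2) (\<Sum>i=1..p-1. weight (p - 1) i * poly f (of_nat i ^ 2) / of_nat i ^ 4)"
proof -
  have H: "p_cong (Suc 0) (harmonic2 (p - 1)) 0"
    unfolding harmonic2_def using assms(1) by (intro harmonic_power_cong_0) auto
  have A: "p_cong (Suc 0) (harmonic2 (p - 1) ^ 2) 0"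
    using p_cong_power[OF harmonic2_Zp Zp_0 H, of 2] assms(1) by simp
  have B: "p_cong (Suc 0) (\<Sum>k=1..p-1. 1 / of_nat k ^ 4) 0"
    using assms(1) by (intro harmonic_power_cong_0) auto
  have "p_cong (Suc 0) (of_nat 2 * nested2 (p - 1)) (of_nat 2 * 0)"
    using p_cong_diff[OF A B] by (simp add: harmonic2_square)
  then have N: "p_cong (Suc 0) (nested2 (p - 1)) 0"
    by (rule p_cong_mult_cancel[rotated]) (use not_dvd_less[of 2] assms(1) in simp)
  have Hp: "harmonic2 (p - 1) \<in> Zp" using assms(1) by (intro harmonic2_Zp) simp
  have "p_cong (Suc 0) (nested2 (p - 1) * coeff f 0 - harmonic2 (p - 1) * (coeff f 1 + harmonic2 (p - 1) * coeff f 0)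
      + (\<Sum>i=1..p-1. weight (p - 1) i * poly f (of_nat i ^ 2) / of_nat i ^ 4))
      (0 * coeff f 0 - 0 * (coeff f 1 + harmonic2 (p - 1) * coeff f 0)
      + (\<Sum>i=1..p-1. weight (p - 1) i * poly f (of_nat i ^ 2) / of_nat i ^ 4))"
    using assms(3,4) Hp by (intro p_cong_add p_cong_diff p_cong_mult_right H N p_cong_refl Zp_add Zp_mult)
  then show ?thesis
    unfolding interpolation_coeff_2[OF assms(2), symmetric] by simp
qed

end

section \<open>The congruence\<close>

lemma degree_sq_prod_sum:
  assumes "0 < N"
  shows "degree (\<Sum>k<N. smult (a k) (sq_prod k)) < N"
proof -
  have "degree (\<Sum>k<N. smult (a k) (sq_prod k)) \<le> N - 1"
  proof (rule degree_sum_le)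
    fix k assume k: "k \<in> {..<N}"
    have "degree (smult (a k) (sq_prod k)) \<le> degree (sq_prod k)"
      by (rule degree_smult_le)
    also have "\<dots> \<le> k"
      unfolding sq_prod_def using degree_prod_sq_factor[of "{1..k}"] by simp
    finally show "degree (smult (a k) (sq_prod k)) \<le> N - 1" using k by simp
  qed simp
  then show ?thesis using assms by simp
qed

context p_local
begin

lemma nested2_sum_cong:
  assumes "6 < p" "\<And>k. k < p - 1 \<Longrightarrow> a k \<in> Zp"
  shows "p_cong (Suc 0) (\<Sum>k<p-1. a k * nested2 k)
    (\<Sum>i=1..p-1. weight (p - 1) i * poly (\<Sum>k<p-1. smult (a k) (sq_prod k)) (of_nat i ^ 2) / of_nat i ^ 4)"
proof -
  define f where "f = (\<Sum>k<p-1. smult (a k) (sq_prod k))"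
  have c: "coeff f n = (\<Sum>k<p-1. a k * coeff (sq_prod k) n)" for n
    by (simp add: f_def coeff_sum)
  have "degree f < p - 1"
    unfolding f_def using assms(1) by (intro degree_sq_prod_sum) simp
  moreover have "coeff f 0 \<in> Zp"
    unfolding c coeff_sq_prod using assms(2) by (intro Zp_sum Zp_mult Zp_1) auto
  moreover have "coeff f 1 \<in> Zp"
    unfolding c coeff_sq_prod using assms(2) by (intro Zp_sum Zp_mult Zp_uminus harmonic2_Zp) auto
  ultimately have "p_cong (Suc 0) (coeff f 2) (\<Sum>i=1..p-1. weight (p - 1) i * poly f (of_nat i ^ 2) / of_nat i ^ 4)"
    by (intro coeff_2_cong assms(1))
  then show ?thesis
    unfolding c coeff_sq_prod unfolding f_def .
qed

section \<open>Reduction to weighted sums of exponent \<open>- 5\<close>\<close>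

definition alt5 :: rat where
  "alt5 = (\<Sum>i=1..p-1. (-1) ^ i / of_nat i ^ 5)"

definition cos5 :: rat where
  "cos5 = (\<Sum>i=1..p-1. two_cos i / of_nat i ^ 5)"

definition quot5 :: "nat \<Rightarrow> rat" where
  "quot5 a = (\<Sum>r=1..p-1. of_nat (quot a r) / of_nat r ^ 5)"

text \<open>The weights have \<open>p\<close> in the denominator and the coefficients
  \<open>1 / k\<close> do not cancel it. So the interpolation sum is multiplied by \<open>p\<close>,
  evaluated modulo \<open>p ^ 2\<close> and divided by \<open>p\<close> again.\<close>

lemma nested2_harmonic_sum_cong:
  assumes "6 < p"
  shows "p_cong (Suc 0) (\<Sum>k=1..p-1. nested2 (k - 1) / of_nat k) (- 4 * alt5)"
proof -
  define Z where "Z = (\<Sum>i=1..p-1. weight (p - 1) i * poly (harmonic_poly (p - 1)) (of_nat i ^ 2) / of_nat i ^ 4)"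
  have "of_nat p * Z = (\<Sum>i=1..p-1. 2 * ((-1) ^ i * theta i / of_nat i ^ 4))"
    unfolding Z_def sum_distrib_left
  proof (rule sum.cong[OF refl])
    fix i assume i: "i \<in> {1..p-1}"
    have "of_nat p * (weight (p - 1) i * poly (harmonic_poly (p - 1)) (of_nat i ^ 2) / of_nat i ^ 4)
        = (of_nat p * weight (p - 1) i) * (- ((-1) ^ i) / of_nat i) / of_nat i ^ 4"
      using i by (simp add: poly_harmonic_poly)
    also have "\<dots> = 2 * ((-1) ^ i * theta i / of_nat i ^ 4)"
      using i by (subst p_mult_weight) auto
    finally show "of_nat p * (weight (p - 1) i * poly (harmonic_poly (p - 1)) (of_nat i ^ 2) / of_nat i ^ 4) = \<dots>" .
  qed
  also have "\<dots> = 2 * (\<Sum>i=1..p-1. (-1) ^ i * theta i / of_nat i ^ 4)"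
    by (simp only: sum_distrib_left)
  also have "p_cong 2 \<dots> (of_nat p * (- 4 * alt5))"
    unfolding alt5_def using assms by (intro alternating_theta_sum) simp
  finally have "p_cong (Suc 0) Z (- 4 * alt5)"
    unfolding numeral_2_eq_2 p_cong_p_mult_iff .
  moreover have "p_cong (Suc 0) (\<Sum>k<p-1. 1 / of_nat (Suc k) * nested2 k) Z"
    unfolding Z_def harmonic_poly_def
    using Zp_one_divide[of "Suc k" 1 for k] assms by (intro nested2_sum_cong) auto
  ultimately have "p_cong (Suc 0) (\<Sum>k<p-1. 1 / of_nat (Suc k) * nested2 k) (- 4 * alt5)"
    using p_cong_trans by blast
  moreover have "(\<Sum>k<p-1. 1 / of_nat (Suc k) * nested2 k) = (\<Sum>k=1..p-1. nested2 (k - 1) / of_nat k)"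
    by (simp only: One_nat_def sum.atLeast1_atMost_eq) simp
  ultimately show ?thesis by simp
qed

lemma two_cos_Zp: "two_cos i \<in> Zp"
proof -
  have "i mod 6 = 0 \<or> i mod 6 = 1 \<or> i mod 6 = 2 \<or> i mod 6 = 3 \<or> i mod 6 = 4 \<or> i mod 6 = 5" by linarith
  then show ?thesis
    unfolding two_cos_def by (elim disjE) (simp_all add: Zp_uminus)
qed

text \<open>Here the coefficients carry a factor \<open>p\<close> that cancels the denominator of
  the weights, so \<open>theta\<close> enters only modulo \<open>p\<close>. The constant in
  \<open>two_cos i - 2\<close> contributes a vanishing power sum.\<close>

lemma nested2_central_sum_cong:
  assumes "6 < p"
  shows "p_cong (Suc 0) (of_nat p * (\<Sum>n=1..p-1. nested2 (n - 1) / (of_nat n ^ 2 * of_nat ((2 * n) choose n)))) cos5"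
proof -
  define b :: "nat \<Rightarrow> rat" where "b k = 1 / (of_nat (Suc k) ^ 2 * of_nat ((2 * Suc k) choose Suc k))" for k
  have pb: "of_nat p * b k \<in> Zp" if "k < p - 1" for k
  proof -
    have "of_nat p / of_nat ((2 * Suc k) choose Suc k) / of_nat (Suc k) ^ 2 \<in> Zp"
      using that by (intro Zp_divide_power p_div_central_binomial_Zp not_dvd_less) auto
    then show ?thesis by (simp add: b_def mult_ac del: of_nat_Suc binomial_Suc_Suc)
  qed
  have "of_nat p * (\<Sum>n=1..p-1. nested2 (n - 1) / (of_nat n ^ 2 * of_nat ((2 * n) choose n)))
      = (\<Sum>k<p-1. of_nat p * b k * nested2 k)"
    by (simp only: One_nat_def sum.atLeast1_atMost_eq sum_distrib_left) (simp add: b_def)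
  also have "p_cong (Suc 0) \<dots> (\<Sum>i=1..p-1. weight (p - 1) i
      * poly (\<Sum>k<p-1. smult (of_nat p * b k) (sq_prod k)) (of_nat i ^ 2) / of_nat i ^ 4)"
    using assms pb by (rule nested2_sum_cong)
  also have "\<dots> = (\<Sum>i=1..p-1. (two_cos i - 2) / of_nat i ^ 5 * theta i)"
  proof (rule sum.cong[OF refl])
    fix i assume i: "i \<in> {1..p-1}"
    then have i': "0 < i" by simp
    have "poly (\<Sum>k<p-1. smult (of_nat p * b k) (sq_prod k)) (of_nat i ^ 2)
        = of_nat p * poly (central_poly (p - 1)) (of_nat i ^ 2)"
      by (simp add: central_poly_def b_def poly_sum sum_distrib_left)
    also have "\<dots> = of_nat p * ((1 - two_cos i / 2) / of_nat i ^ 2)"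
      using i by (simp add: poly_central_poly)
    finally have 1: "weight (p - 1) i * poly (\<Sum>k<p-1. smult (of_nat p * b k) (sq_prod k)) (of_nat i ^ 2) / of_nat i ^ 4
        = (of_nat p * weight (p - 1) i) * ((1 - two_cos i / 2) / of_nat i ^ 2) / of_nat i ^ 4"
      by simp
    have gen: "- 2 * x * t * ((1 - c / 2) / x ^ 2) / x ^ 4 = (c - 2) / x ^ 5 * t" if "x \<noteq> 0" for x t c :: rat
      using that by (simp add: divide_simps) (simp add: algebra_simps eval_nat_numeral)
    show "weight (p - 1) i * poly (\<Sum>k<p-1. smult (of_nat p * b k) (sq_prod k)) (of_nat i ^ 2) / of_nat i ^ 4
        = (two_cos i - 2) / of_nat i ^ 5 * theta i"
      unfolding 1 p_mult_weight[OF i'] by (rule gen) (use i in simp)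
  qed
  also have "p_cong (Suc 0) \<dots> (\<Sum>i=1..p-1. (two_cos i - 2) / of_nat i ^ 5 * 1)"
  proof (intro p_cong_sum p_cong_mult_left)
    fix i assume i: "i \<in> {1..p-1}"
    show "p_cong (Suc 0) (theta i) 1" using i by (intro theta_cong_1) auto
    show "(two_cos i - 2) / of_nat i ^ 5 \<in> Zp"
      using i by (intro Zp_divide_power Zp_diff two_cos_Zp Zp_numeral not_dvd_less) auto
  qed
  also have "\<dots> = cos5 - 2 * (\<Sum>i=1..p-1. 1 / of_nat i ^ 5)"
    by (simp add: cos5_def diff_divide_distrib sum_subtractf sum_distrib_left)
  also have "p_cong (Suc 0) \<dots> (cos5 - 2 * 0)"
    using assms by (intro p_cong_diff p_cong_refl p_cong_mult_left harmonic_power_cong_0 Zp_numeral) auto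
  finally show ?thesis by simp
qed

text \<open>With \<open>r = k - 1\<close>, the factor \<open>p / fact (p + r)\<close> is
  \<open>- 1 / fact r\<close>, and the remaining factorials combine by reflection.\<close>

lemma fact_quotient_cong:
  assumes "0 < k" "k < p"
  shows "p_cong (Suc 0) ((fact (k - 1))\<^sup>2 * (of_nat p * (fact (p - 1 - k) / fact (p - 1 + k)))) ((-1) ^ k / of_nat k)"
proof -
  obtain r where k: "k = Suc r" using assms by (cases k) auto
  have pk: "p - 1 + k = p + r" using assms by (simp add: k)
  have "(fact (k - 1))\<^sup>2 * (of_nat p * (fact (p - 1 - k) / fact (p - 1 + k)))
      = (fact r)\<^sup>2 * fact (p - 1 - k) * (of_nat p / fact (p + r) :: rat)"
    unfolding pk by (simp add: k)
  also have "p_cong (Suc 0) \<dots> ((fact r)\<^sup>2 * fact (p - 1 - k) * (- (1 / fact r)))"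
    using assms by (intro p_cong_mult_left p_div_fact Zp_mult Zp_power Zp_fact) (simp add: k)
  also have "\<dots> = - (fact (p - 1 - k) * fact k) / of_nat k"
    by (simp add: k power2_eq_square del: of_nat_Suc)
  also have "p_cong (Suc 0) \<dots> (- ((-1) ^ Suc k) / of_nat k)"
    using assms by (intro p_cong_divide p_cong_uminus p_cong_fact_reflect not_dvd_less)
  finally show ?thesis by simp
qed

text \<open>\<open>leshchiner_finite\<close> at the even number \<open>N = p - 1\<close>, times
  \<open>2 * p\<close>. Multiplied by \<open>p\<close>, the three sums on its right become 0,
  \<open>cos5\<close> and, through \<open>fact_quotient_cong\<close>,
  \<open>- 4 * alt5\<close>.\<close>

lemma central_inverse_sum_cong:
  assumes "6 < p"
  shows "p_cong (Suc 0) (4 * (of_nat p * (\<Sum>n=1..p-1. (1 / of_nat n ^ 6 - harmonic2 (n - 1) / of_nat n ^ 4) / of_nat ((2 * n) choose n))))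
    (4 * alt5 - 3 * cos5)"
proof -
  define W where "W = (\<Sum>n=1..p-1. (1 / of_nat n ^ 6 - harmonic2 (n - 1) / of_nat n ^ 4) / of_nat ((2 * n) choose n))"
  define A :: rat where "A = (\<Sum>n=1..p-1. (-1) ^ n / of_nat n ^ 6)"
  define D where "D = (\<Sum>n=1..p-1. nested2 (n - 1) / (of_nat n ^ 2 * of_nat ((2 * n) choose n)))"
  define R where "R = (\<Sum>k=1..p-1. (-1) ^ k * (fact (k - 1))\<^sup>2 * nested2 (k - 1) * (fact (p - 1 - k) / fact (p - 1 + k)))"
  have "odd p" using prime_p assms prime_odd_nat by simp
  then have W: "2 * W = - A - 3 / 2 * D - 1 / 2 * R"
    using leshchiner_finite[of "p - 1"] unfolding W_def A_def D_def R_def by simp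
  have "4 * (of_nat p * W) = 2 * of_nat p * (2 * W)" by simp
  also have "\<dots> = - 2 * (of_nat p * A) - 3 * (of_nat p * D) - of_nat p * R"
    unfolding W by (simp add: algebra_simps)
  finally have eq: "4 * (of_nat p * W) = \<dots>" .
  have A: "p_cong (Suc 0) (of_nat p * A) 0"
    unfolding A_def
    by (intro p_cong_p_mult_0 Zp_sum Zp_divide_power Zp_power Zp_uminus Zp_1 not_dvd_less) auto
  have D: "p_cong (Suc 0) (of_nat p * D) cos5"
    unfolding D_def using assms by (rule nested2_central_sum_cong)
  have "of_nat p * R = (\<Sum>k=1..p-1. (-1) ^ k * nested2 (k - 1)
      * ((fact (k - 1))\<^sup>2 * (of_nat p * (fact (p - 1 - k) / fact (p - 1 + k)))))"
    unfolding R_def sum_distrib_left by (intro sum.cong refl) (simp only: mult_ac)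
  also have "p_cong (Suc 0) \<dots> (\<Sum>k=1..p-1. (-1) ^ k * nested2 (k - 1) * ((-1) ^ k / of_nat k))"
  proof (intro p_cong_sum p_cong_mult_left)
    fix k assume k: "k \<in> {1..p-1}"
    show "(-1) ^ k * nested2 (k - 1) \<in> Zp"
      using k by (intro Zp_mult Zp_power Zp_uminus Zp_1 nested2_Zp) auto
    show "p_cong (Suc 0) ((fact (k - 1))\<^sup>2 * (of_nat p * (fact (p - 1 - k) / fact (p - 1 + k)))) ((-1) ^ k / of_nat k)"
      using k by (intro fact_quotient_cong) auto
  qed
  also have "\<dots> = (\<Sum>k=1..p-1. nested2 (k - 1) / of_nat k)"
    by (intro sum.cong refl) (simp add: mult_ac flip: power_mult_distrib)
  also have "p_cong (Suc 0) \<dots> (- 4 * alt5)"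
    using assms by (rule nested2_harmonic_sum_cong)
  finally have R: "p_cong (Suc 0) (of_nat p * R) (- 4 * alt5)" .
  have "p_cong (Suc 0) (4 * (of_nat p * W)) (- 2 * 0 - 3 * cos5 - - 4 * alt5)"
    unfolding eq by (intro p_cong_diff p_cong_mult_left A D R Zp_uminus Zp_numeral)
  then show ?thesis unfolding W_def by simp
qed

text \<open>In the first half of the range the central binomials are prime to \<open>p\<close>, so
  the factor \<open>p\<close> kills the terms. In the second half \<open>n = p - j\<close>, and
  \<open>harmonic2 (n - 1)\<close> becomes \<open>- harmonic2 j\<close>, which changes the
  sign.\<close>

lemma reflected_sum_cong:
  assumes "3 < p"
  shows "p_cong (Suc 0)
    (\<Sum>j=1..(p - 1) div 2. of_nat p / (of_nat j ^ 4 * of_nat ((2 * p - 2 * j) choose (p - j))) * (1 / of_nat j ^ 2 + harmonic2 j))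
    (of_nat p * (\<Sum>n=1..p-1. (1 / of_nat n ^ 6 - harmonic2 (n - 1) / of_nat n ^ 4) / of_nat ((2 * n) choose n)))"
proof -
  define h where "h = (p - 1) div 2"
  have "odd p" using prime_p assms prime_odd_nat by simp
  then have h: "p = 2 * h + 1" by (simp add: h_def)
  define t where "t n = 1 / of_nat n ^ 6 - harmonic2 (n - 1) / of_nat n ^ 4" for n
  define C where "C n = (of_nat ((2 * n) choose n) :: rat)" for n
  have t_Zp: "t n \<in> Zp" if "0 < n" "n < p" for n
    unfolding t_def using that by (intro Zp_diff Zp_one_divide Zp_divide_power harmonic2_Zp not_dvd_less) auto
  have "{1..p-1} = {1..h} \<union> {Suc h..p-1}" using h by auto
  then have "of_nat p * (\<Sum>n=1..p-1. t n / C n)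
      = (\<Sum>n=1..h. of_nat p * (1 / C n * t n)) + (\<Sum>n=Suc h..p-1. of_nat p / C n * t n)"
    by (simp add: sum.union_disjoint sum_distrib_left distrib_left)
  also have "(\<Sum>n=Suc h..p-1. of_nat p / C n * t n) = (\<Sum>j=1..h. of_nat p / C (p - j) * t (p - j))"
    by (rule sum.reindex_bij_witness[of _ "\<lambda>k. p - k" "\<lambda>k. p - k"]) (use h in auto)
  also have "p_cong (Suc 0) ((\<Sum>n=1..h. of_nat p * (1 / C n * t n)) + (\<Sum>j=1..h. of_nat p / C (p - j) * t (p - j)))
      ((\<Sum>n=1..h. 0) + (\<Sum>j=1..h. of_nat p / C (p - j) * (1 / of_nat j ^ 6 + harmonic2 j / of_nat j ^ 4)))"
  proof (intro p_cong_add p_cong_sum p_cong_p_mult_0 p_cong_mult_left Zp_mult t_Zp)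
    fix n assume "n \<in> {1..h}"
    then show "1 / C n \<in> Zp"
      unfolding C_def using h by (intro inverse_central_binomial_Zp) auto
  next
    fix j assume "j \<in> {1..h}"
    then have j: "0 < j" "j < p" using h by auto
    show "of_nat p / C (p - j) \<in> Zp"
      unfolding C_def using j by (intro p_div_central_binomial_Zp) simp
    have "p_cong (Suc 0) (harmonic2 (p - j - 1)) (- harmonic2 j)"
      using harmonic_reflect[of 2 j] j assms by (simp add: harmonic2_def diff_commute)
    moreover have "p_cong (Suc 0) (1 / of_nat (p - j) ^ 4) (1 / of_nat j ^ 4)"
      "p_cong (Suc 0) (1 / of_nat (p - j) ^ 6) (1 / of_nat j ^ 6)"
      using p_cong_inverse_reflect[OF j(1,2), of 4] p_cong_inverse_reflect[OF j(1,2), of 6] by simp_all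
    ultimately have "p_cong (Suc 0) (1 / of_nat (p - j) ^ 6 - harmonic2 (p - j - 1) * (1 / of_nat (p - j) ^ 4))
        (1 / of_nat j ^ 6 - - harmonic2 j * (1 / of_nat j ^ 4))"
      using j by (intro p_cong_diff p_cong_mult harmonic2_Zp Zp_one_divide) auto
    then show "p_cong (Suc 0) (t (p - j)) (1 / of_nat j ^ 6 + harmonic2 j / of_nat j ^ 4)"
      by (simp add: t_def)
  qed (use h in auto)
  also have "(\<Sum>n=1..h. 0) + (\<Sum>j=1..h. of_nat p / C (p - j) * (1 / of_nat j ^ 6 + harmonic2 j / of_nat j ^ 4))
      = (\<Sum>j=1..h. of_nat p / (of_nat j ^ 4 * of_nat ((2 * p - 2 * j) choose (p - j))) * (1 / of_nat j ^ 2 + harmonic2 j))"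
    unfolding C_def sum.neutral_const add_0
  proof (intro sum.cong refl)
    fix j :: nat
    have "2 * (p - j) = 2 * p - 2 * j" by simp
    moreover have "1 / x ^ 6 + H / x ^ 4 = (1 / x ^ 2 + H) / x ^ 4" for x H :: rat
      by (simp add: add_divide_distrib flip: power_add)
    ultimately show "of_nat p / of_nat ((2 * (p - j)) choose (p - j)) * (1 / of_nat j ^ 6 + harmonic2 j / of_nat j ^ 4)
        = of_nat p / (of_nat j ^ 4 * of_nat ((2 * p - 2 * j) choose (p - j))) * (1 / of_nat j ^ 2 + harmonic2 j)"
      by (simp add: mult_ac)
  qed
  finally show ?thesis
    unfolding h_def t_def C_def by (rule p_cong_sym)
qed

section \<open>Weights of period 6 and the multipliers 2, 3 and 6\<close>

lemma p_mod_6: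
  assumes "3 < p"
  shows "p mod 6 = 1 \<or> p mod 6 = 5"
proof -
  have "\<not> 2 dvd p" "\<not> 3 dvd p"
    using prime_p assms by (auto simp: prime_nat_iff)
  then show ?thesis by presburger
qed

text \<open>For odd \<open>p\<close> the number \<open>quot 2 r\<close> is the parity of
  \<open>r\<close>.\<close>

lemma alt5_cong:
  assumes "6 < p"
  shows "p_cong (Suc 0) alt5 (- 2 * quot5 2)"
proof -
  have "odd p" using prime_p assms prime_odd_nat by simp
  then have "(-1) ^ r = (1 - 2 * of_nat (quot 2 r) :: rat)" for r
    by (cases "even r") (auto simp: quot_def mod2_eq_if)
  then have "alt5 = (\<Sum>i=1..p-1. 1 / of_nat i ^ 5) - 2 * quot5 2"
    by (simp add: alt5_def quot5_def diff_divide_distrib sum_subtractf sum_distrib_left)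
  also have "p_cong (Suc 0) \<dots> (0 - 2 * quot5 2)"
    using assms by (intro p_cong_diff p_cong_refl harmonic_power_cong_0) auto
  finally show ?thesis by simp
qed

lemma quot_mod_6:
  assumes "a dvd 6"
  shows "quot a r = ((a - 1) * (p mod 6) * (r mod 6)) mod a"
proof -
  have "[x = x mod 6] (mod a)" for x
    using assms by (simp add: cong_def mod_mod_cancel)
  then have "[(a - 1) * p * r = (a - 1) * (p mod 6) * (r mod 6)] (mod a)"
    by (intro cong_mult cong_refl)
  then show ?thesis by (simp only: quot_def cong_def)
qed

text \<open>A check over residues modulo 6: \<open>2 * two_cos r\<close> and the combination of the
  Voronoi weights have the same odd part under reflection of \<open>r\<close>.\<close>

lemma two_cos_quot_reflect:
  assumes "3 < p" "r < p"
  shows "2 * two_cos r - (of_nat (quot 2 r) + of_nat (quot 3 r) - of_nat (quot 6 r))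
    = 2 * two_cos (p - r) - (of_nat (quot 2 (p - r)) + of_nat (quot 3 (p - r)) - of_nat (quot 6 (p - r)))"
proof -
  define s where "s = p - r"
  have q: "quot 2 x = ((p mod 6) * (x mod 6)) mod 2" "quot 3 x = (2 * (p mod 6) * (x mod 6)) mod 3"
    "quot 6 x = (5 * (p mod 6) * (x mod 6)) mod 6" for x
    using quot_mod_6[of 2 x] quot_mod_6[of 3 x] quot_mod_6[of 6 x] by simp_all
  have sum: "(r mod 6 + s mod 6) mod 6 = p mod 6"
    unfolding mod_add_eq using assms(2) by (simp add: s_def)
  have c: "x mod 6 = 0 \<or> x mod 6 = 1 \<or> x mod 6 = 2 \<or> x mod 6 = 3 \<or> x mod 6 = 4 \<or> x mod 6 = 5" for x :: nat
    by linarith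
  show ?thesis
    unfolding s_def[symmetric] q two_cos_def
    using p_mod_6[OF assms(1)] c[of r] c[of s] sum by (elim disjE) simp_all
qed

text \<open>The difference \<open>\<phi>\<close> of the weights is even under reflection while
  \<open>1 / r ^ 5\<close> is odd modulo \<open>p\<close>, so the sum \<open>F\<close> is congruent
  to \<open>- F\<close>.\<close>

lemma cos5_cong:
  assumes "6 < p"
  shows "p_cong (Suc 0) (2 * cos5) (quot5 2 + quot5 3 - quot5 6)"
proof -
  define \<phi> where "\<phi> r = 2 * two_cos r - (of_nat (quot 2 r) + of_nat (quot 3 r) - of_nat (quot 6 r))" for r
  define F where "F = (\<Sum>r=1..p-1. \<phi> r / of_nat r ^ 5)"
  have \<phi>_Zp: "\<phi> r \<in> Zp" for r
    unfolding \<phi>_def by (intro Zp_diff Zp_add Zp_mult two_cos_Zp Zp_numeral Zp_of_nat)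
  have F: "F = 2 * cos5 - (quot5 2 + quot5 3 - quot5 6)"
    by (simp add: F_def \<phi>_def cos5_def quot5_def diff_divide_distrib add_divide_distrib
        sum_subtractf sum.distrib sum_distrib_left)
  have "F = (\<Sum>r=1..p-1. \<phi> (p - r) * (1 / of_nat (p - r) ^ 5))"
    using sum_reflect[of "\<lambda>r. \<phi> r / of_nat r ^ 5"] by (simp add: F_def)
  also have "\<dots> = (\<Sum>r=1..p-1. \<phi> r * (1 / of_nat (p - r) ^ 5))"
  proof (intro sum.cong refl)
    fix r assume "r \<in> {1..p-1}"
    then have "\<phi> r = \<phi> (p - r)"
      unfolding \<phi>_def using assms by (intro two_cos_quot_reflect) auto
    then show "\<phi> (p - r) * (1 / of_nat (p - r) ^ 5) = \<phi> r * (1 / of_nat (p - r) ^ 5)" by simp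
  qed
  also have "p_cong (Suc 0) \<dots> (\<Sum>r=1..p-1. \<phi> r * ((-1) ^ 5 / of_nat r ^ 5))"
    using \<phi>_Zp by (intro p_cong_sum p_cong_mult_left p_cong_inverse_reflect) auto
  also have "\<dots> = - F" by (simp add: F_def sum_negf)
  finally have "p_cong (Suc 0) (F + F) (F + - F)" by (intro p_cong_add p_cong_refl)
  then have "p_cong (Suc 0) (of_nat 2 * F) (of_nat 2 * 0)" by simp
  then have "p_cong (Suc 0) F 0"
    by (rule p_cong_mult_cancel[rotated]) (use not_dvd_less[of 2] assms in simp)
  then have "p_cong (Suc 0) (F + (quot5 2 + quot5 3 - quot5 6)) (0 + (quot5 2 + quot5 3 - quot5 6))"
    by (intro p_cong_add p_cong_refl)
  then show ?thesis by (simp add: F)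
qed

lemma quot5_cong:
  assumes "6 < p" "a \<in> {2, 3, 6}"
  shows "p_cong (Suc 0) (quot5 a) ((1 - 1 / of_nat a ^ 4) / 5 * bernoulli (p - 5))"
  unfolding quot5_def
proof (rule sum_quot_div_power_5)
  have "p\<^sup>2 mod 6 = 1"
    using p_mod_6 assms(1) by (auto simp: power_mod[symmetric, of p])
  then have "6 dvd p\<^sup>2 - 1" by (metis dvd_minus_mod)
  moreover have "a dvd 6" using assms(2) by auto
  ultimately show "a dvd p\<^sup>2 - 1" by (rule dvd_trans[rotated])
qed (use assms in auto)

lemma reflected_sum_bernoulli:
  assumes "6 < p"
  shows "p_cong (Suc 0)
    (- 2 * (\<Sum>j=1..(p - 1) div 2. of_nat p / (of_nat j ^ 4 * of_nat ((2 * p - 2 * j) choose (p - j))) * (1 / of_nat j ^ 2 + harmonic2 j)))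
    (8 / 9 * bernoulli (p - 5))"
proof -
  define B where "B = bernoulli (p - 5)"
  define M where "M = (\<Sum>j=1..(p - 1) div 2. of_nat p / (of_nat j ^ 4 * of_nat ((2 * p - 2 * j) choose (p - j))) * (1 / of_nat j ^ 2 + harmonic2 j))"
  \<comment> \<open>The constants are \<open>(1 - 1 / a ^ 4) / 5\<close> for
    \<open>a = 2, 3, 6\<close>.\<close>
  have V: "p_cong (Suc 0) (quot5 2) (3 / 16 * B)" "p_cong (Suc 0) (quot5 3) (16 / 81 * B)"
    "p_cong (Suc 0) (quot5 6) (259 / 1296 * B)"
    using quot5_cong[OF assms, of 2] quot5_cong[OF assms, of 3] quot5_cong[OF assms, of 6] by (simp_all add: B_def)
  have "p_cong (Suc 0) (4 * M) (4 * alt5 - 3 * cos5)"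
    unfolding M_def using assms
    by (intro p_cong_trans[OF p_cong_mult_left[OF _ reflected_sum_cong] central_inverse_sum_cong]) auto
  then have "p_cong (Suc 0) (- 2 * (4 * M)) (- 2 * (4 * alt5 - 3 * cos5))"
    by (intro p_cong_mult_left Zp_uminus Zp_numeral)
  also have "- 2 * (4 * alt5 - 3 * cos5) = 3 * (2 * cos5) - 8 * alt5" by simp
  also have "p_cong (Suc 0) \<dots> (3 * (quot5 2 + quot5 3 - quot5 6) - 8 * (- 2 * quot5 2))"
    using assms by (intro p_cong_diff p_cong_mult_left cos5_cong alt5_cong Zp_numeral)
  also have "p_cong (Suc 0) \<dots> (3 * (3 / 16 * B + 16 / 81 * B - 259 / 1296 * B) - 8 * (- 2 * (3 / 16 * B)))"
    using V by (intro p_cong_diff p_cong_add p_cong_mult_left Zp_numeral Zp_uminus)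
  \<comment> \<open>The coefficient of \<open>B\<close> is
    \<open>3 * (3 / 16 + 16 / 81 - 259 / 1296) + 3 = 32 / 9\<close>, which is
    \<open>4 * (8 / 9)\<close>.\<close>
  finally have "p_cong (Suc 0) (of_nat 4 * (- 2 * M)) (of_nat 4 * (8 / 9 * B))"
    by simp
  then show ?thesis
    unfolding M_def B_def by (rule p_cong_mult_cancel[rotated]) (use not_dvd_less[of 4] assms in simp)
qed

end

lemma bernoulli_0: "bernoulli 0 = 1"
  using power_sum_bernoulli[of 0 1] by simp

theorem theorem2:
  fixes p :: nat
  assumes "prime p" and "p > 3"
  shows
    "rat_cong
       (\<Sum>j = 1..(p - 1) div 2.
          of_nat ((2 * j) choose j) / of_nat j ^ 3 * (1 / of_nat j ^ 2 + harmonic2 j))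
       (- 2 * (\<Sum>j = 1..(p - 1) div 2.
          of_nat p / (of_nat j ^ 4 * of_nat ((2 * p - 2 * j) choose (p - j))) *
            (1 / of_nat j ^ 2 + harmonic2 j)))
       p
     \<and>
     rat_cong
       (- 2 * (\<Sum>j = 1..(p - 1) div 2.
          of_nat p / (of_nat j ^ 4 * of_nat ((2 * p - 2 * j) choose (p - j))) *
            (1 / of_nat j ^ 2 + harmonic2 j)))
       (8 / 9 * bernoulli (p - 5))
       p"
    (is "rat_cong ?S ?T p \<and> _")
proof -
  interpret p_local p by unfold_locales (rule assms(1))
  have 1: "p_cong (Suc 0) ?S ?T"
    using assms(2) by (intro central_sum_cong_reflected Zp_add Zp_one_divide harmonic2_Zp) auto
  have 2: "p_cong (Suc 0) ?T (8 / 9 * bernoulli (p - 5))"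
  proof (cases "6 < p")
    case True
    then show ?thesis by (rule reflected_sum_bernoulli)
  next
    case False
    have "odd p" using assms prime_odd_nat by simp
    with False assms(2) have p: "p = 5" by presburger
    \<comment> \<open>For \<open>p = 5\<close> the first sum is \<open>4 + 9 / 8\<close> and the
      Bernoulli number is \<open>bernoulli 0 = 1\<close>; the difference
      \<open>41 / 8 - 8 / 9\<close> equals \<open>5 * 61 / 72\<close>. The first congruence carries
      this over to the second sum.\<close>
    have "{1..(p - 1) div 2} = {1, 2}" by (auto simp: p)
    then have S: "?S = 41 / 8"
      by (simp add: harmonic2_def numeral_2_eq_2 power2_eq_square)
    have "(41 / 8 - 8 / 9 * bernoulli 0) / of_nat p = of_int 61 / of_int 72"
      by (simp add: p bernoulli_0)
    then have "p_cong (Suc 0) ?S (8 / 9 * bernoulli (p - 5))"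
      unfolding p_cong_def power_Suc0_right S by (intro ZpI[of 72]) (simp_all add: p)
    then show ?thesis by (rule p_cong_trans[OF p_cong_sym[OF 1]])
  qed
  show ?thesis
    using p_cong_imp_rat_cong[OF 1] p_cong_imp_rat_cong[OF 2] ..
qed

end
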